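(* Let $q\ge 2$ be an integer and let $\mathcal{G}$ be a geometrically finite, asymptotically $(q+1)$-regular graph of groups with compact core having $|\mathcal{L}|$ vertices, $n_c$ cusps and $n_f$ (orbifold) funnels. Then the number of resonances of $\mathcal{G}$ is finite. More specifically: (1) The number of resonances, counted without multiplicity, is bounded by $2|\mathcal{L}|$. (2) The multiplicity of any given resonance is bounded by $3\,(|\mathcal{L}|+2n_c+(q+1)n_f)^2$.
   Context: A graph of groups $\mathcal{G}$ consists of a connected, locally finite graph with countable vertex set $\mathcal{V}$ and edge set $\mathcal{E}$ (loops and multiple edges allowed), finite groups $G_v$ ($v\in\mathcal{V}$) and $G_e$ ($e\in\mathcal{E}$), and for each oriented edge $\vec e$ (every edge, including a loop, has two orientations; $\vec e$ has origin $o(\vec e)$ and terminus $t(\vec e)$) a monomorphism $G_e\hookrightarrow G_{t(\vec e)}$. Put $\mathcal{S}(v)=|G_v|$, $\mathcal{S}(e)=|G_e|$. The degree of $v$ is $\deg(v)=\sum_{\vec e: t(\vec e)=v}\mathcal{S}(v)/\mathcal{S}(e)$. A graph of groups with boundary may in addition have half-edges ("prongs") $h$ emanating from a vertex $v$, with a group $G_h$ and a monomorphism $G_h\hookrightarrow G_v$; prongs are counted in the degree. Cutting an edge replaces it by a prong at each of its two endpoints. An orbifold funnel is a graph of groups with boundary whose underlying graph is a locally finite rooted tree with root $o$, with one prong $h$ emanating from $o$, such that $G_o=G_h$ and $G_v=G_{\{v,w\}}\le G_w$ whenever $\{v,w\}$ is an edge with $w$ closer to $o$ than $v$. A cusp is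 a graph of groups with boundary whose underlying graph is a ray with vertices $0,1,2,\dots$, with one prong emanating from the root $0$, such that $G_i=G_{\{i,i+1\}}$ for all $i\ge 0$. $\mathcal{G}$ is geometrically finite and asymptotically $(q+1)$-regular if it can be cut along finitely many edges into finitely many pieces: one finite graph of groups with boundary (the compact core $\mathcal{L}$, not necessarily $(q+1)$-regular), and the rest ($n_f$ orbifold funnels and $n_c$ cusps) having all vertices of degree $q+1$. Such a decomposition is fixed. The adjacency operator $A$ acts on functions $f:\mathcal{V}\to\mathbb{C}$ by $Af(v)=\sum_{\vec e:t(\vec e)=v}\frac{\mathcal{S}(v)}{\mathcal{S}(e)}f(o(\vec e))$. $\ell^2(\mathcal{V})=\{f:\sum_v|f(v)|^2/\mathcal{S}(v)<\infty\}$ and, for $\rho:\mathcal{V}\to\mathbb{R}_+$, $\rho\,\ell^2(\mathcal{V})=\{f:\sum_v|f(v)|^2/(\rho(v)^2\mathcal{S}(v))<\infty\}$. $d$ is the path distance in the underlying graph; $o$ is a base point in $\mathcal{L}$; $z(\mu)=\frac{\mu+\mu^{-1}}2$. For $|\mu|$ large, $R_{\mathcal{G}}(\mu)=(\frac{A}{2\sqrt q}-z(\mu))^{-1}$ on $\ell^2(\mathcal{V})$. For every $N\ge0$ it continues, from large $|\mu|$, to a finitely meromorphic family (i.e. meromorphic with finite-rank coefficients at negative powers) of operators $q^{-Nd(o,\cdot)}\ell^2(\mathcal{V})\to q^{Nd(o,\cdot)}\ell^2(\mathcal{V})$ on $|\mu|>q^{1/2-N}$, compatibly for different $N$. A resonance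 is a pole $\mu_0\in\mathbb{C}^\times$ of this continuation. Writing $R_{\mathcal{G}}(\mu)=\sum_{j=1}^J\frac{A_{-j}}{(\mu-\mu_0)^j}+R_{\mathrm{hol}}(\mu)$ near $\mu_0$ with $R_{\mathrm{hol}}$ holomorphic, the multiplicity of $\mu_0$ is $\dim\,\mathrm{span}(\mathrm{im}A_{-1}\cup\dots\cup\mathrm{im}A_{-J})$. *)

theory Defs
  imports
    "HOL-Analysis.Analysis"
    "HOL-Library.Function_Algebras"
    "HOL-Algebra.Coset"
    "Graph_Theory.Arc_Walk"
    "Graph_Theory.Bidirected_Digraph"
    "Graph_Theory.Digraph_Component"
begin

section \<open>Graphs of groups with boundary\<close>

text \<open>
  The arcs of the underlying digraph are the oriented edges; an (unoriented) edge is a pair of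
  distinct arcs exchanged by \<open>flip\<close>, also when the edge is a loop.  For an arc \<open>e\<close> the map
  \<open>emono G e\<close> is the monomorphism from the edge group into the group of the terminus \<open>head e\<close>.
  A prong is an arc-like half-edge that points to the vertex it emanates from: this vertex is its
  \<open>head\<close>, and its \<open>tail\<close> is meaningless.
\<close>

record ('v, 'e, 'g, 'h) gog =
  ugraph :: "('v, 'e) pre_digraph"
  flip :: "'e \<Rightarrow> 'e"
  prongs :: "'e set"
  vgroup :: "'v \<Rightarrow> 'g monoid"
  egroup :: "'e \<Rightarrow> 'h monoid"
  emono :: "'e \<Rightarrow> 'h \<Rightarrow> 'g"

locale graph_of_groups_with_boundary =
  fixes G :: "('v, 'e, 'g, 'h) gog"
  assumes bidirected: "bidirected_digraph (ugraph G) (flip G)"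
    and connected: "strongly_connected (ugraph G)"
    and countable_verts: "countable (verts (ugraph G))"
    and locally_finite: "v \<in> verts (ugraph G) \<Longrightarrow> finite (in_arcs (ugraph G) v)"
    and prongs_not_arcs: "prongs G \<inter> arcs (ugraph G) = {}"
    and prong_vertex: "h \<in> prongs G \<Longrightarrow> head (ugraph G) h \<in> verts (ugraph G)"
    and locally_finite_prongs:
      "v \<in> verts (ugraph G) \<Longrightarrow> finite {h \<in> prongs G. head (ugraph G) h = v}"
    and vertex_group:
      "v \<in> verts (ugraph G) \<Longrightarrow> group (vgroup G v) \<and> finite (carrier (vgroup G v))"
    and edge_group:
      "e \<in> arcs (ugraph G) \<union> prongs G \<Longrightarrow> group (egroup G e) \<and> finite (carrier (egroup G e))"
    and edge_group_flip: "e \<in> arcs (ugraph G) \<Longrightarrow> egroup G (flip G e) = egroup G e"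
    and edge_mono: "e \<in> arcs (ugraph G) \<union> prongs G \<Longrightarrow>
      emono G e \<in> mon (egroup G e) (vgroup G (head (ugraph G) e))"

definition graph_of_groups :: "('v, 'e, 'g, 'h) gog \<Rightarrow> bool" where
  "graph_of_groups G \<longleftrightarrow> graph_of_groups_with_boundary G \<and> prongs G = {}"

definition vsize :: "('v, 'e, 'g, 'h) gog \<Rightarrow> 'v \<Rightarrow> real" where
  "vsize G v = real (Coset.order (vgroup G v))"

definition esize :: "('v, 'e, 'g, 'h) gog \<Rightarrow> 'e \<Rightarrow> real" where
  "esize G e = real (Coset.order (egroup G e))"

definition degree :: "('v, 'e, 'g, 'h) gog \<Rightarrow> 'v \<Rightarrow> real" where
  "degree G v =
    (\<Sum>e \<in> in_arcs (ugraph G) v \<union> {h \<in> prongs G. head (ugraph G) h = v}. vsize G v / esize G e)"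

definition gdist :: "('v, 'e, 'g, 'h) gog \<Rightarrow> 'v \<Rightarrow> 'v \<Rightarrow> nat" where
  "gdist G u v = (LEAST n. \<exists>p. pre_digraph.awalk (ugraph G) u p v \<and> length p = n)"


section \<open>Cutting, funnels and cusps\<close>

text \<open>
  \<open>F\<close> is a set of arcs closed under \<open>flip\<close>.  Each arc in \<open>F\<close> becomes a prong at its terminus, so
  that every cut edge leaves one prong at each of its two endpoints.  Outside the arcs \<open>flip\<close> is
  the identity, as demanded by the locale \<^locale>\<open>bidirected_digraph\<close>.
\<close>

definition cut :: "('v, 'e, 'g, 'h) gog \<Rightarrow> 'e set \<Rightarrow> ('v, 'e, 'g, 'h) gog" where
  "cut G F = G\<lparr>
     ugraph := (ugraph G)\<lparr>arcs := arcs (ugraph G) - F\<rparr>,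
     flip := (\<lambda>e. if e \<in> F then e else flip G e),
     prongs := prongs G \<union> F\<rparr>"

definition piece :: "('v, 'e, 'g, 'h) gog \<Rightarrow> 'v set \<Rightarrow> ('v, 'e, 'g, 'h) gog" where
  "piece G W = G\<lparr>
     ugraph := induce_subgraph (ugraph G) W,
     flip := (\<lambda>e. if e \<in> arcs (induce_subgraph (ugraph G) W) then flip G e else e),
     prongs := {h \<in> prongs G. head (ugraph G) h \<in> W}\<rparr>"

text \<open>A tree has no cycles apart from an edge followed by its own reversal.\<close>

definition underlying_tree :: "('v, 'e, 'g, 'h) gog \<Rightarrow> bool" where
  "underlying_tree G \<longleftrightarrow> strongly_connected (ugraph G) \<and>
     (\<forall>p. pre_digraph.cycle (ugraph G) p \<longrightarrow> (\<exists>e. p = [e, flip G e]))"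

text \<open>
  The equalities of groups in the definitions of funnels and cusps are taken along the given
  monomorphisms: the monomorphism in question is an isomorphism.
\<close>

definition orbifold_funnel :: "('v, 'e, 'g, 'h) gog \<Rightarrow> bool" where
  "orbifold_funnel G \<longleftrightarrow> graph_of_groups_with_boundary G \<and> underlying_tree G \<and>
     (\<exists>r \<in> verts (ugraph G). \<exists>h.
        prongs G = {h} \<and> head (ugraph G) h = r \<and>
        emono G h \<in> iso (egroup G h) (vgroup G r) \<and>
        (\<forall>e \<in> arcs (ugraph G).
           gdist G r (tail (ugraph G) e) < gdist G r (head (ugraph G) e) \<longrightarrow>
           emono G e \<in> iso (egroup G e) (vgroup G (head (ugraph G) e))))"

definition cusp :: "('v, 'e, 'g, 'h) gog \<Rightarrow> bool" where
  "cusp G \<longleftrightarrow> graph_of_groups_with_boundary G \<and>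
     (\<exists>(x :: nat \<Rightarrow> 'v) (e :: nat \<Rightarrow> 'e) h.
        bij_betw x UNIV (verts (ugraph G)) \<and>
        arcs (ugraph G) = range e \<union> flip G ` range e \<and>
        (\<forall>i. tail (ugraph G) (e i) = x i \<and> head (ugraph G) (e i) = x (Suc i)) \<and>
        prongs G = {h} \<and> head (ugraph G) h = x 0 \<and>
        (\<forall>i. emono G (flip G (e i)) \<in> iso (egroup G (flip G (e i))) (vgroup G (x i))))"

text \<open>
  \<open>G\<close> is geometrically finite and asymptotically \<open>(q + 1)\<close>-regular, by means of the following
  decomposition: cutting along \<open>F\<close> leaves as connected components the core with vertex set \<open>L\<close>,
  the funnels with vertex sets in \<open>Fs\<close> and the cusps with vertex sets in \<open>Cs\<close>.  (The underlying
  digraph being symmetric, its strongly connected components are its connected components.)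
\<close>

definition geometrically_finite ::
  "nat \<Rightarrow> ('v, 'e, 'g, 'h) gog \<Rightarrow> 'e set \<Rightarrow> 'v set \<Rightarrow> 'v set set \<Rightarrow> 'v set set \<Rightarrow> bool" where
  "geometrically_finite q G F L Fs Cs \<longleftrightarrow>
     graph_of_groups G \<and>
     F \<subseteq> arcs (ugraph G) \<and> finite F \<and> flip G ` F \<subseteq> F \<and>
     pre_digraph.sccs_verts (ugraph (cut G F)) = insert L (Fs \<union> Cs) \<and>
     L \<notin> Fs \<union> Cs \<and> Fs \<inter> Cs = {} \<and>
     finite L \<and> finite Fs \<and> finite Cs \<and>
     (\<forall>W \<in> Fs. orbifold_funnel (piece (cut G F) W)) \<and>
     (\<forall>W \<in> Cs. cusp (piece (cut G F) W)) \<and>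
     (\<forall>W \<in> Fs \<union> Cs. \<forall>v \<in> W. degree (piece (cut G F) W) v = real q + 1)"


section \<open>Weighted spaces and operators between them\<close>

text \<open>A function on the vertex set is extended by zero to the whole vertex type.\<close>

definition adjacency :: "('v, 'e, 'g, 'h) gog \<Rightarrow> ('v \<Rightarrow> complex) \<Rightarrow> 'v \<Rightarrow> complex" where
  "adjacency G f v =
    (if v \<in> verts (ugraph G)
     then \<Sum>e \<in> in_arcs (ugraph G) v. of_real (vsize G v / esize G e) * f (tail (ugraph G) e)
     else 0)"

definition wl2 :: "('v, 'e, 'g, 'h) gog \<Rightarrow> ('v \<Rightarrow> real) \<Rightarrow> ('v \<Rightarrow> complex) set" where
  "wl2 G \<rho> = {f. (\<forall>v. v \<notin> verts (ugraph G) \<longrightarrow> f v = 0) \<and>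
     (\<lambda>v. (cmod (f v))\<^sup>2 / ((\<rho> v)\<^sup>2 * vsize G v)) summable_on verts (ugraph G)}"

definition wl2_norm :: "('v, 'e, 'g, 'h) gog \<Rightarrow> ('v \<Rightarrow> real) \<Rightarrow> ('v \<Rightarrow> complex) \<Rightarrow> real" where
  "wl2_norm G \<rho> f =
     sqrt (\<Sum>\<^sub>\<infinity>v \<in> verts (ugraph G). (cmod (f v))\<^sup>2 / ((\<rho> v)\<^sup>2 * vsize G v))"

abbreviation ell2 :: "('v, 'e, 'g, 'h) gog \<Rightarrow> ('v \<Rightarrow> complex) set" where
  "ell2 G \<equiv> wl2 G (\<lambda>_. 1)"

definition cscale :: "complex \<Rightarrow> ('v \<Rightarrow> complex) \<Rightarrow> 'v \<Rightarrow> complex" where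
  "cscale c f = (\<lambda>v. c * f v)"

global_interpretation cfun: vector_space "cscale :: complex \<Rightarrow> ('v \<Rightarrow> complex) \<Rightarrow> 'v \<Rightarrow> complex"
  by unfold_locales (auto simp: cscale_def fun_eq_iff algebra_simps)

type_synonym 'v op = "('v \<Rightarrow> complex) \<Rightarrow> ('v \<Rightarrow> complex)"

text \<open>
  In the following \<open>\<rho>\<close> and \<open>\<sigma>\<close> are the weights of the domain and of the target space.  Only the
  restriction of an operator to its domain \<open>wl2 G \<rho>\<close> matters.
\<close>

definition bounded_op ::
  "('v, 'e, 'g, 'h) gog \<Rightarrow> ('v \<Rightarrow> real) \<Rightarrow> ('v \<Rightarrow> real) \<Rightarrow> 'v op \<Rightarrow> bool" where
  "bounded_op G \<rho> \<sigma> T \<longleftrightarrow>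
     (\<forall>f \<in> wl2 G \<rho>. T f \<in> wl2 G \<sigma>) \<and>
     (\<forall>f \<in> wl2 G \<rho>. \<forall>g \<in> wl2 G \<rho>. T (f + g) = T f + T g) \<and>
     (\<forall>c. \<forall>f \<in> wl2 G \<rho>. T (cscale c f) = cscale c (T f)) \<and>
     (\<exists>C. \<forall>f \<in> wl2 G \<rho>. wl2_norm G \<sigma> (T f) \<le> C * wl2_norm G \<rho> f)"

definition finite_rank :: "('v, 'e, 'g, 'h) gog \<Rightarrow> ('v \<Rightarrow> real) \<Rightarrow> 'v op \<Rightarrow> bool" where
  "finite_rank G \<rho> T \<longleftrightarrow> (\<exists>B. finite B \<and> T ` wl2 G \<rho> \<subseteq> cfun.span B)"

text \<open>Complex differentiability with respect to the operator norm, on an open set \<open>U\<close>:\<close>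

definition holomorphic_family ::
  "('v, 'e, 'g, 'h) gog \<Rightarrow> ('v \<Rightarrow> real) \<Rightarrow> ('v \<Rightarrow> real) \<Rightarrow> complex set \<Rightarrow>
   (complex \<Rightarrow> 'v op) \<Rightarrow> bool" where
  "holomorphic_family G \<rho> \<sigma> U T \<longleftrightarrow>
     (\<forall>\<mu> \<in> U. bounded_op G \<rho> \<sigma> (T \<mu>) \<and>
       (\<exists>D. bounded_op G \<rho> \<sigma> D \<and>
         (\<forall>\<epsilon>>0. \<forall>\<^sub>F \<nu> in at \<mu>. \<forall>f \<in> wl2 G \<rho>.
            wl2_norm G \<sigma> (cscale (1 / (\<nu> - \<mu>)) (T \<nu> f - T \<mu> f) - D f) \<le> \<epsilon> * wl2_norm G \<rho> f)))"

text \<open>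
  Laurent expansion with finite-rank principal part \<open>\<Sum>j=1..J. C j / (\<mu> - \<mu>\<^sub>0) ^ j\<close>.  The value of
  the family at \<open>\<mu>\<^sub>0\<close> itself is immaterial.
\<close>

definition has_principal_part ::
  "('v, 'e, 'g, 'h) gog \<Rightarrow> ('v \<Rightarrow> real) \<Rightarrow> ('v \<Rightarrow> real) \<Rightarrow> (complex \<Rightarrow> 'v op) \<Rightarrow>
   complex \<Rightarrow> nat \<Rightarrow> (nat \<Rightarrow> 'v op) \<Rightarrow> bool" where
  "has_principal_part G \<rho> \<sigma> R \<mu>\<^sub>0 J C \<longleftrightarrow>
     (\<forall>j \<in> {1..J}. bounded_op G \<rho> \<sigma> (C j) \<and> finite_rank G \<rho> (C j)) \<and>
     (\<exists>r>0. \<exists>Rhol. holomorphic_family G \<rho> \<sigma> (ball \<mu>\<^sub>0 r) Rhol \<and>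
       (\<forall>\<mu> \<in> ball \<mu>\<^sub>0 r - {\<mu>\<^sub>0}. \<forall>f \<in> wl2 G \<rho>.
          R \<mu> f = (\<Sum>j = 1..J. cscale (1 / (\<mu> - \<mu>\<^sub>0) ^ j) (C j f)) + Rhol \<mu> f))"

definition finitely_meromorphic ::
  "('v, 'e, 'g, 'h) gog \<Rightarrow> ('v \<Rightarrow> real) \<Rightarrow> ('v \<Rightarrow> real) \<Rightarrow> complex set \<Rightarrow>
   (complex \<Rightarrow> 'v op) \<Rightarrow> bool" where
  "finitely_meromorphic G \<rho> \<sigma> U R \<longleftrightarrow> (\<forall>\<mu>\<^sub>0 \<in> U. \<exists>J C. has_principal_part G \<rho> \<sigma> R \<mu>\<^sub>0 J C)"


section \<open>Resolvent and resonances\<close>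

definition zmu :: "complex \<Rightarrow> complex" where
  "zmu \<mu> = (\<mu> + inverse \<mu>) / 2"

definition shifted_adjacency :: "('v, 'e, 'g, 'h) gog \<Rightarrow> nat \<Rightarrow> complex \<Rightarrow> 'v op" where
  "shifted_adjacency G q \<mu> f =
     cscale (1 / (2 * of_real (sqrt (real q)))) (adjacency G f) - cscale (zmu \<mu>) f"

definition resolvent :: "('v, 'e, 'g, 'h) gog \<Rightarrow> nat \<Rightarrow> complex \<Rightarrow> 'v op" where
  "resolvent G q \<mu> = inv_into (ell2 G) (shifted_adjacency G q \<mu>)"

definition exp_weight :: "('v, 'e, 'g, 'h) gog \<Rightarrow> nat \<Rightarrow> 'v \<Rightarrow> real \<Rightarrow> 'v \<Rightarrow> real" where
  "exp_weight G q b N v = real q powr (N * real (gdist G b v))"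

text \<open>
  \<open>R\<close> is the continuation of the resolvent, from large \<open>\<bar>\<mu>\<bar>\<close>, as a finitely meromorphic family of
  operators from \<open>q\<^bsup>-N d(b,\<cdot>)\<^esup> \<ell>\<^sup>2\<close> to \<open>q\<^bsup>N d(b,\<cdot>)\<^esup> \<ell>\<^sup>2\<close> on \<open>\<bar>\<mu>\<bar> > q\<^bsup>1/2 - N\<^esup>\<close>.  The domain is contained in
  \<open>\<ell>\<^sup>2\<close>, and the region is connected, so that \<open>R\<close> is unique off its poles; continuations for
  different \<open>N\<close> agree on the smaller domain for the same reason.
\<close>

definition resolvent_continuation ::
  "('v, 'e, 'g, 'h) gog \<Rightarrow> nat \<Rightarrow> 'v \<Rightarrow> real \<Rightarrow> (complex \<Rightarrow> 'v op) \<Rightarrow> bool" where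
  "resolvent_continuation G q b N R \<longleftrightarrow>
     finitely_meromorphic G (exp_weight G q b (- N)) (exp_weight G q b N)
       {\<mu>. cmod \<mu> > real q powr (1/2 - N)} R \<and>
     (\<exists>M. \<forall>\<mu>. cmod \<mu> > M \<longrightarrow>
        bij_betw (shifted_adjacency G q \<mu>) (ell2 G) (ell2 G) \<and>
        (\<forall>f \<in> wl2 G (exp_weight G q b (- N)). R \<mu> f = resolvent G q \<mu> f))"

text \<open>The principal part at \<open>\<mu>\<^sub>0\<close> of the continued resolvent, seen on the spaces with parameter \<open>N\<close>:\<close>

definition resolvent_principal_part ::
  "('v, 'e, 'g, 'h) gog \<Rightarrow> nat \<Rightarrow> 'v \<Rightarrow> complex \<Rightarrow> real \<Rightarrow> nat \<Rightarrow> (nat \<Rightarrow> 'v op) \<Rightarrow> bool" where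
  "resolvent_principal_part G q b \<mu>\<^sub>0 N J C \<longleftrightarrow>
     N \<ge> 0 \<and> cmod \<mu>\<^sub>0 > real q powr (1/2 - N) \<and>
     (\<exists>R. resolvent_continuation G q b N R \<and>
        has_principal_part G (exp_weight G q b (- N)) (exp_weight G q b N) R \<mu>\<^sub>0 J C)"

definition resonances :: "('v, 'e, 'g, 'h) gog \<Rightarrow> nat \<Rightarrow> 'v \<Rightarrow> complex set" where
  "resonances G q b = {\<mu>\<^sub>0. \<mu>\<^sub>0 \<noteq> 0 \<and>
     (\<exists>N J C. resolvent_principal_part G q b \<mu>\<^sub>0 N J C \<and>
        (\<exists>j \<in> {1..J}. \<exists>f \<in> wl2 G (exp_weight G q b (- N)). C j f \<noteq> 0))}"

text \<open>
  The multiplicity does not depend on \<open>N\<close>: the finite-rank operators \<open>C j\<close> have the same image on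
  the spaces for different \<open>N\<close>, because the smaller domains are dense.
\<close>

definition has_multiplicity ::
  "('v, 'e, 'g, 'h) gog \<Rightarrow> nat \<Rightarrow> 'v \<Rightarrow> complex \<Rightarrow> nat \<Rightarrow> bool" where
  "has_multiplicity G q b \<mu>\<^sub>0 m \<longleftrightarrow>
     (\<exists>N J C. resolvent_principal_part G q b \<mu>\<^sub>0 N J C \<and>
        m = cfun.dim (cfun.span (\<Union>j \<in> {1..J}. C j ` wl2 G (exp_weight G q b (- N)))))"

end

theory Submission
  imports Defs "HOL-Complex_Analysis.Meromorphic" "Jordan_Normal_Form.Char_Poly"
begin

text \<open>
  On an end every vertex \<open>w\<close> has a parent, and the group orders are such that for a solution of
  \<open>(A / (2 sqrt q) - z(\<mu>)) u = \<delta>\<^sub>y\<close> the defect \<open>u w - c / (sqrt q * \<mu>) * u (parent w)\<close> satisfies a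
  first-order recursion in the defects of the children of \<open>w\<close>.  If \<open>\<bar>\<mu>\<bar> > 1\<close> and \<open>u\<close> is square summable,
  the defect vanishes above \<open>y\<close>, hence everywhere it is a polynomial in \<open>1 / \<mu>\<close>.  So, up to functions
  holomorphic for \<open>\<mu> \<noteq> 0\<close>, \<open>u\<close> is determined by its restriction to the core, and there it solves
  \<open>(\<mu>\<^sup>2 - \<mu> M + K) u = h\<close> with constant matrices \<open>M\<close>, \<open>K\<close> and \<open>h\<close> holomorphic for \<open>\<mu> \<noteq> 0\<close>.  Therefore
  \<open>p(\<mu>) u\<close> is holomorphic on the core for the polynomial \<open>p = det (\<mu>\<^sup>2 - \<mu> M + K)\<close> of degree \<open>2 \<bar>L\<bar>\<close>.
  Both facts persist for the continued resolvent.  Hence resonances are roots of \<open>p\<close>, and at a root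
  \<open>\<mu>\<^sub>0\<close> of order \<open>n\<close> the principal part takes values in the span of \<open>n \<bar>L\<bar>\<close> functions, namely of the
  first \<open>n\<close> Taylor coefficients at \<open>\<mu>\<^sub>0\<close> of the outgoing solutions.
\<close>


section \<open>Linear systems over polynomials\<close>

text \<open>Funnels and cusps can be treated alike because in both the degree condition yields one
  identity: the sum of S(w) S(c) / S(e)^2 over the children c of w, with e the edge between them,
  equals q. It makes the defect satisfy a first-order recursion, and it fits Cauchy-Schwarz so
  exactly that the energy of the defect grows by the factor |\<mu>|^2. The obstacle in the
  continuation is that the holomorphic error terms depend on the source y, with no estimate uniform
  in y. So the identities are continued only for point sources and at single vertices, as identities
  of scalar meromorphic functions. In the negative Laurent coefficients the error terms drop out.
  The remaining relation between the \<open>C j\<close> does not mention y, and as the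
  \<open>C j\<close> are bounded and finitely supported functions are dense, it extends to every f.
  The multiplicity bound comes from n |L| with n at most the degree of p, that is, from 2
  |L|^2.\<close>

text \<open>Cramer's rule without division: the adjugate is taken of the matrix
  \<open>\<mu> - C\<close> with polynomial entries, so one family \<open>Q\<close> serves all \<mu>,
  including the eigenvalues of \<open>C\<close>.\<close>

lemma linear_system_char_poly:
  fixes C :: "complex mat"
  assumes C: "C \<in> carrier_mat m m"
  shows "\<exists>Q :: nat \<Rightarrow> nat \<Rightarrow> complex poly. \<forall>\<mu> x y.
    (\<forall>i<m. \<mu> * x i - (\<Sum>j<m. C $$ (i, j) * x j) = y i) \<longrightarrow>
    (\<forall>i<m. poly (char_poly C) \<mu> * x i = (\<Sum>j<m. poly (Q i j) \<mu> * y j))"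
proof -
  define A where "A = char_poly_matrix C"
  have A: "A \<in> carrier_mat m m" using C by (simp add: A_def)
  have A_entry: "A $$ (j, k) = (if j = k then [:0, 1:] else 0) - [:C $$ (j, k):]" if "j < m" "k < m" for j k
    using that C by (auto simp: A_def char_poly_matrix_def)
  note adj = adj_mat[OF A]
  have "poly (char_poly C) \<mu> * x i = (\<Sum>j<m. poly (adj_mat A $$ (i, j)) \<mu> * y j)"
    if sys: "\<forall>i<m. \<mu> * x i - (\<Sum>j<m. C $$ (i, j) * x j) = y i" and i: "i < m" for \<mu> x y i
  proof -
    have y: "y j = (\<Sum>k<m. poly (A $$ (j, k)) \<mu> * x k)" if j: "j < m" for j
    proof -
      have "(\<Sum>k<m. poly (A $$ (j, k)) \<mu> * x k) =
          (\<Sum>k<m. (if j = k then \<mu> * x k else 0) - C $$ (j, k) * x k)"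
        using j by (intro sum.cong) (auto simp: A_entry algebra_simps)
      also have "\<dots> = \<mu> * x j - (\<Sum>k<m. C $$ (j, k) * x k)"
        using j by (simp add: sum_subtractf)
      finally show ?thesis using sys j by simp
    qed
    have "(\<Sum>j<m. poly (adj_mat A $$ (i, j)) \<mu> * y j) =
        (\<Sum>j<m. \<Sum>k<m. poly (adj_mat A $$ (i, j)) \<mu> * (poly (A $$ (j, k)) \<mu> * x k))"
      by (intro sum.cong) (auto simp: y sum_distrib_left)
    also have "\<dots> = (\<Sum>k<m. \<Sum>j<m. poly (adj_mat A $$ (i, j)) \<mu> * (poly (A $$ (j, k)) \<mu> * x k))"
      by (rule sum.swap)
    also have "\<dots> = (\<Sum>k<m. poly ((adj_mat A * A) $$ (i, k)) \<mu> * x k)"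
      using i A adj(1)
      by (intro sum.cong) (auto simp: scalar_prod_def poly_sum sum_distrib_right mult.assoc lessThan_atLeast0)
    also have "\<dots> = (\<Sum>k<m. if i = k then poly (char_poly C) \<mu> * x k else 0)"
      using i by (intro sum.cong) (auto simp: adj(3) char_poly_def simp flip: A_def)
    also have "\<dots> = poly (char_poly C) \<mu> * x i" using i by simp
    finally show ?thesis by simp
  qed
  then show ?thesis by (intro exI[of _ "\<lambda>i j. adj_mat A $$ (i, j)"]) blast
qed

text \<open>Linearising to twice the size makes \<open>p\<close> a characteristic polynomial, hence
  monic of degree \<open>2 * card L\<close>; this settles \<open>p \<noteq> 0\<close> as
  well.\<close>

lemma quadratic_system_poly:
  fixes M :: "'v \<Rightarrow> 'v \<Rightarrow> complex" and K :: "'v \<Rightarrow> complex"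
  assumes L: "finite L"
  shows "\<exists>p Q :: 'v \<Rightarrow> 'v \<Rightarrow> complex poly. p \<noteq> 0 \<and> Polynomial.degree p = 2 * card L \<and>
    (\<forall>\<mu> x y. (\<forall>v\<in>L. \<mu>\<^sup>2 * x v - \<mu> * (\<Sum>w\<in>L. M v w * x w) + K v * x v = y v) \<longrightarrow>
       (\<forall>v\<in>L. poly p \<mu> * x v = (\<Sum>w\<in>L. poly (Q v w) \<mu> * y w)))"
proof -
  define n where "n = card L"
  obtain g where g: "bij_betw g {..<n} L"
    using ex_bij_betw_nat_finite[OF L] by (auto simp: n_def lessThan_atLeast0)
  \<comment> \<open>the companion matrix, for the unknowns \<open>x\<close> and \<open>\<mu> x\<close>\<close>
  define C where "C = mat (2 * n) (2 * n) (\<lambda>(i, j).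
     if i < n then (if j = n + i then 1 else 0)
     else if j < n then (if j = i - n then - K (g j) else 0)
     else M (g (i - n)) (g (j - n)))"
  have C: "C \<in> carrier_mat (2 * n) (2 * n)" by (simp add: C_def)
  obtain Q where Q: "\<forall>\<mu> x y. (\<forall>i<2 * n. \<mu> * x i - (\<Sum>j<2 * n. C $$ (i, j) * x j) = y i) \<longrightarrow>
      (\<forall>i<2 * n. poly (char_poly C) \<mu> * x i = (\<Sum>j<2 * n. poly (Q i j) \<mu> * y j))"
    using linear_system_char_poly[OF C] by blast
  define h where "h = inv_into {..<n} g"
  have h: "h v < n" "g (h v) = v" if "v \<in> L" for v
    using that g bij_betw_inv_into_right[OF g that] bij_betwE[OF bij_betw_inv_into[OF g]] by (auto simp: h_def)
  have hg: "h (g i) = i" if "i < n" for i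
    using bij_betw_inv_into_left[OF g] that by (simp add: h_def)
  have gL: "g i \<in> L" if "i < n" for i using g that by (auto simp: bij_betw_def)
  have "(\<Sum>j<n + m. F j) = (\<Sum>j<n. F j) + (\<Sum>j<m. F (n + j))" for F :: "nat \<Rightarrow> complex" and m
    by (induction m) (simp_all add: algebra_simps)
  note split = this[of _ n, folded mult_2]
  have main: "poly (char_poly C) \<mu> * x v = (\<Sum>w\<in>L. poly (Q (h v) (n + h w)) \<mu> * y w)"
    if sys: "\<forall>v\<in>L. \<mu>\<^sup>2 * x v - \<mu> * (\<Sum>w\<in>L. M v w * x w) + K v * x v = y v" and v: "v \<in> L" for \<mu> x y v
  proof -
    \<comment> \<open>The vector (x, \<mu> x) and the source (0, y): the upper rows hold
      identically, the lower rows are the quadratic system. The zero block leaves only the columns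
      \<open>n + h w\<close> of \<open>Q\<close>.\<close>
    define X where "X i = (if i < n then x (g i) else \<mu> * x (g (i - n)))" for i
    define Y where "Y i = (if i < n then 0 else y (g (i - n)))" for i
    have "\<mu> * X i - (\<Sum>j<2 * n. C $$ (i, j) * X j) = Y i" if i: "i < 2 * n" for i
    proof (cases "i < n")
      case True
      have "(\<Sum>j<2 * n. C $$ (i, j) * X j) = (\<Sum>j<2 * n. if j = n + i then \<mu> * x (g i) else 0)"
        using True by (intro sum.cong) (auto simp: C_def X_def)
      then show ?thesis using True by (simp add: X_def Y_def)
    next
      case False
      have "(\<Sum>j<2 * n. C $$ (i, j) * X j) =
          (\<Sum>j<n. if j = i - n then - K (g j) * x (g j) else 0) + (\<Sum>j<n. M (g (i - n)) (g j) * (\<mu> * x (g j)))"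
        unfolding split using False i by (intro arg_cong2[where f="(+)"] sum.cong) (auto simp: C_def X_def)
      also have "(\<Sum>j<n. M (g (i - n)) (g j) * (\<mu> * x (g j))) = \<mu> * (\<Sum>w\<in>L. M (g (i - n)) w * x w)"
        unfolding sum_distrib_left by (subst sum.reindex_bij_betw[OF g, symmetric]) (simp add: mult_ac)
      also have "(\<Sum>j<n. if j = i - n then - K (g j) * x (g j) else 0) = - K (g (i - n)) * x (g (i - n))"
        using False i by simp
      finally have eq: "(\<Sum>j<2 * n. C $$ (i, j) * X j) =
          - K (g (i - n)) * x (g (i - n)) + \<mu> * (\<Sum>w\<in>L. M (g (i - n)) w * x w)" .
      show ?thesis
        unfolding eq using False i bspec[OF sys, of "g (i - n)"] gL[of "i - n"]
        by (simp add: X_def Y_def power2_eq_square algebra_simps)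
    qed
    with Q h(1)[OF v]
    have "poly (char_poly C) \<mu> * X (h v) = (\<Sum>j<2 * n. poly (Q (h v) j) \<mu> * Y j)" by simp
    also have "\<dots> = (\<Sum>j<n. poly (Q (h v) (n + h (g j))) \<mu> * y (g j))"
      unfolding split by (simp add: Y_def hg)
    also have "\<dots> = (\<Sum>w\<in>L. poly (Q (h v) (n + h w)) \<mu> * y w)"
      by (rule sum.reindex_bij_betw[OF g])
    finally show ?thesis using h[OF v] by (simp add: X_def)
  qed
  have deg: "Polynomial.degree (char_poly C) = 2 * card L \<and> coeff (char_poly C) (2 * n) = 1"
    using degree_monic_char_poly[OF C] by (simp add: n_def)
  then have "char_poly C \<noteq> 0" by auto
  then show ?thesis
    using deg main by (intro exI[of _ "char_poly C"] exI[of _ "\<lambda>v w. Q (h v) (n + h w)"]) blast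
qed

section \<open>Weighted spaces and principal parts\<close>

lemma vsize_nonneg: "0 \<le> vsize G v"
  by (simp add: vsize_def)

lemma wl2_weight_nonneg: "0 \<le> (\<rho> v)\<^sup>2 * vsize G v"
  by (simp add: vsize_nonneg)

lemma wl2_summable:
  "f \<in> wl2 G \<rho> \<Longrightarrow> (\<lambda>v. (cmod (f v))\<^sup>2 / ((\<rho> v)\<^sup>2 * vsize G v)) summable_on verts (ugraph G)"
  by (simp add: wl2_def)

lemma wl2_outside: "f \<in> wl2 G \<rho> \<Longrightarrow> v \<notin> verts (ugraph G) \<Longrightarrow> f v = 0"
  by (simp add: wl2_def)

lemma wl2_finite_support:
  assumes "finite S" "S \<subseteq> verts (ugraph G)" "\<And>v. v \<notin> S \<Longrightarrow> f v = 0"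
  shows "f \<in> wl2 G \<rho>"
proof -
  have "(\<lambda>v. (cmod (f v))\<^sup>2 / ((\<rho> v)\<^sup>2 * vsize G v)) summable_on S"
    using assms(1) by (rule summable_on_finite)
  then have "(\<lambda>v. (cmod (f v))\<^sup>2 / ((\<rho> v)\<^sup>2 * vsize G v)) summable_on verts (ugraph G)"
    using assms by (subst summable_on_cong_neutral[of S "verts (ugraph G)"]) auto
  then show ?thesis using assms by (auto simp: wl2_def)
qed

lemma wl2_dominated:
  assumes "f \<in> wl2 G \<rho>" "\<And>v. cmod (g v) \<le> cmod (f v)"
  shows "g \<in> wl2 G \<rho>"
proof -
  have "(\<lambda>v. (cmod (g v))\<^sup>2 / ((\<rho> v)\<^sup>2 * vsize G v)) summable_on verts (ugraph G)"
    by (rule summable_on_comparison_test[OF wl2_summable[OF assms(1)]])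
      (auto intro!: divide_right_mono power_mono assms(2) wl2_weight_nonneg divide_nonneg_nonneg)
  moreover have "g v = 0" if "v \<notin> verts (ugraph G)" for v
    using assms(2)[of v] wl2_outside[OF assms(1) that] by simp
  ultimately show ?thesis by (auto simp: wl2_def)
qed

lemma wl2_add:
  assumes "f \<in> wl2 G \<rho>" "g \<in> wl2 G \<rho>"
  shows "f + g \<in> wl2 G \<rho>"
proof -
  have le: "(cmod (f v + g v))\<^sup>2 / w \<le> 2 * ((cmod (f v))\<^sup>2 / w) + 2 * ((cmod (g v))\<^sup>2 / w)" if "0 \<le> w" for v w
  proof -
    have "(cmod (f v + g v))\<^sup>2 \<le> (cmod (f v) + cmod (g v))\<^sup>2"
      by (intro power_mono norm_triangle_ineq) auto
    also have "\<dots> \<le> 2 * (cmod (f v))\<^sup>2 + 2 * (cmod (g v))\<^sup>2"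
      using sum_squares_bound[of "cmod (f v)" "cmod (g v)"] by (simp add: power2_sum)
    finally have "(cmod (f v + g v))\<^sup>2 / w \<le> (2 * (cmod (f v))\<^sup>2 + 2 * (cmod (g v))\<^sup>2) / w"
      using that by (rule divide_right_mono)
    then show ?thesis by (simp add: add_divide_distrib)
  qed
  have "(\<lambda>v. 2 * ((cmod (f v))\<^sup>2 / ((\<rho> v)\<^sup>2 * vsize G v)) + 2 * ((cmod (g v))\<^sup>2 / ((\<rho> v)\<^sup>2 * vsize G v)))
      summable_on verts (ugraph G)"
    by (intro summable_on_add summable_on_cmult_right wl2_summable assms)
  then have "(\<lambda>v. (cmod (f v + g v))\<^sup>2 / ((\<rho> v)\<^sup>2 * vsize G v)) summable_on verts (ugraph G)"
    by (rule summable_on_comparison_test)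
      (rule le[OF wl2_weight_nonneg], rule divide_nonneg_nonneg, simp, rule wl2_weight_nonneg)
  then show ?thesis using assms by (auto simp: wl2_def)
qed

lemma wl2_cscale:
  assumes "f \<in> wl2 G \<rho>"
  shows "cscale c f \<in> wl2 G \<rho>"
proof -
  have "(\<lambda>v. (cmod c)\<^sup>2 * ((cmod (f v))\<^sup>2 / ((\<rho> v)\<^sup>2 * vsize G v))) summable_on verts (ugraph G)"
    by (intro summable_on_cmult_right wl2_summable assms)
  then show ?thesis using assms
    by (auto simp: wl2_def cscale_def norm_mult power_mult_distrib)
qed

lemma wl2_diff:
  assumes "f \<in> wl2 G \<rho>" "g \<in> wl2 G \<rho>"
  shows "f - g \<in> wl2 G \<rho>"
proof -
  have "f - g = f + cscale (- 1) g" by (auto simp: cscale_def fun_eq_iff)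
  then show ?thesis using assms by (simp only: wl2_add wl2_cscale)
qed

lemma wl2_norm_square:
  assumes "f \<in> wl2 G \<rho>"
  shows "(wl2_norm G \<rho> f)\<^sup>2 = (\<Sum>\<^sub>\<infinity>v \<in> verts (ugraph G). (cmod (f v))\<^sup>2 / ((\<rho> v)\<^sup>2 * vsize G v))"
  unfolding wl2_norm_def
  by (intro real_sqrt_pow2 infsum_nonneg divide_nonneg_nonneg wl2_weight_nonneg) auto

lemma wl2_norm_nonneg: "0 \<le> wl2_norm G \<rho> f"
  unfolding wl2_norm_def
  by (intro real_sqrt_ge_zero infsum_nonneg divide_nonneg_nonneg wl2_weight_nonneg) auto

text \<open>A single term of the norm. Since point evaluations are continuous, operator-valued
  families can be studied entry by entry.\<close>

lemma wl2_eval_le: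
  assumes f: "f \<in> wl2 G \<rho>" and v: "v \<in> verts (ugraph G)" and pos: "0 < (\<rho> v)\<^sup>2 * vsize G v"
  shows "cmod (f v) \<le> sqrt ((\<rho> v)\<^sup>2 * vsize G v) * wl2_norm G \<rho> f"
proof -
  have "(\<Sum>v\<in>{v}. (cmod (f v))\<^sup>2 / ((\<rho> v)\<^sup>2 * vsize G v)) \<le> (wl2_norm G \<rho> f)\<^sup>2"
    unfolding wl2_norm_square[OF f]
    by (rule finite_sum_le_infsum[OF wl2_summable[OF f]])
      (use v in \<open>auto intro!: divide_nonneg_nonneg wl2_weight_nonneg\<close>)
  then have "(cmod (f v))\<^sup>2 \<le> (sqrt ((\<rho> v)\<^sup>2 * vsize G v) * wl2_norm G \<rho> f)\<^sup>2"
    using pos by (simp add: power_mult_distrib pos_divide_le_eq mult.commute del: real_sqrt_mult)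
  then show ?thesis
    by (rule power2_le_imp_le) (auto intro!: mult_nonneg_nonneg wl2_norm_nonneg wl2_weight_nonneg)
qed

section \<open>Point sources and bounded functionals\<close>

definition delta :: "'v \<Rightarrow> 'v \<Rightarrow> complex" where
  "delta y = (\<lambda>v. if v = y then 1 else 0)"

lemma delta_in_wl2: "y \<in> verts (ugraph G) \<Longrightarrow> delta y \<in> wl2 G \<rho>"
  by (rule wl2_finite_support[of "{y}"]) (auto simp: delta_def)

definition bounded_functional ::
  "('v, 'e, 'g, 'h) gog \<Rightarrow> ('v \<Rightarrow> real) \<Rightarrow> (('v \<Rightarrow> complex) \<Rightarrow> complex) \<Rightarrow> bool" where
  "bounded_functional G \<rho> \<Lambda> \<longleftrightarrow>
     (\<forall>f \<in> wl2 G \<rho>. \<forall>g \<in> wl2 G \<rho>. \<Lambda> (f + g) = \<Lambda> f + \<Lambda> g) \<and>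
     (\<forall>c. \<forall>f \<in> wl2 G \<rho>. \<Lambda> (cscale c f) = c * \<Lambda> f) \<and>
     (\<exists>B. \<forall>f \<in> wl2 G \<rho>. cmod (\<Lambda> f) \<le> B * wl2_norm G \<rho> f)"

lemma bounded_functional_0: "bounded_functional G \<rho> (\<lambda>_. 0)"
  by (auto simp: bounded_functional_def intro!: exI[of _ 0])

lemma bounded_functional_mult:
  assumes "bounded_functional G \<rho> \<Lambda>"
  shows "bounded_functional G \<rho> (\<lambda>f. c * \<Lambda> f)"
proof -
  obtain B where B: "\<And>f. f \<in> wl2 G \<rho> \<Longrightarrow> cmod (\<Lambda> f) \<le> B * wl2_norm G \<rho> f"
    using assms unfolding bounded_functional_def by blast
  have "cmod (c * \<Lambda> f) \<le> (cmod c * B) * wl2_norm G \<rho> f" if "f \<in> wl2 G \<rho>" for f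
    using mult_left_mono[OF B[OF that], of "cmod c"] by (simp add: norm_mult mult.assoc)
  then have "\<exists>B. \<forall>f \<in> wl2 G \<rho>. cmod (c * \<Lambda> f) \<le> B * wl2_norm G \<rho> f" by blast
  moreover note assms[unfolded bounded_functional_def]
  ultimately show ?thesis
    unfolding bounded_functional_def by (intro conjI) (simp_all add: distrib_left)
qed

lemma bounded_functional_add:
  assumes "bounded_functional G \<rho> \<Lambda>" "bounded_functional G \<rho> \<Lambda>'"
  shows "bounded_functional G \<rho> (\<lambda>f. \<Lambda> f + \<Lambda>' f)"
proof -
  obtain B B' where B: "\<And>f. f \<in> wl2 G \<rho> \<Longrightarrow> cmod (\<Lambda> f) \<le> B * wl2_norm G \<rho> f"
    "\<And>f. f \<in> wl2 G \<rho> \<Longrightarrow> cmod (\<Lambda>' f) \<le> B' * wl2_norm G \<rho> f"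
    using assms unfolding bounded_functional_def by blast
  have "cmod (\<Lambda> f + \<Lambda>' f) \<le> (B + B') * wl2_norm G \<rho> f" if "f \<in> wl2 G \<rho>" for f
    using norm_triangle_ineq[of "\<Lambda> f" "\<Lambda>' f"] B[OF that] by (simp add: algebra_simps)
  then have "\<exists>B. \<forall>f \<in> wl2 G \<rho>. cmod (\<Lambda> f + \<Lambda>' f) \<le> B * wl2_norm G \<rho> f" by blast
  moreover note assms[unfolded bounded_functional_def]
  ultimately show ?thesis
    unfolding bounded_functional_def by (intro conjI) (simp_all add: distrib_left)
qed

lemma bounded_functional_sum:
  assumes "finite I" "\<And>i. i \<in> I \<Longrightarrow> bounded_functional G \<rho> (\<Lambda> i)"
  shows "bounded_functional G \<rho> (\<lambda>f. \<Sum>i\<in>I. \<Lambda> i f)"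
  using assms by (induction I) (auto intro: bounded_functional_0 bounded_functional_add)

lemma bounded_functional_eval:
  assumes T: "bounded_op G \<rho> \<sigma> T" and v: "v \<in> verts (ugraph G)" and pos: "0 < (\<sigma> v)\<^sup>2 * vsize G v"
  shows "bounded_functional G \<rho> (\<lambda>f. T f v)"
proof -
  obtain B where B: "\<And>f. f \<in> wl2 G \<rho> \<Longrightarrow> wl2_norm G \<sigma> (T f) \<le> B * wl2_norm G \<rho> f"
    using T unfolding bounded_op_def by blast
  have "cmod (T f v) \<le> (sqrt ((\<sigma> v)\<^sup>2 * vsize G v) * B) * wl2_norm G \<rho> f" if f: "f \<in> wl2 G \<rho>" for f
  proof -
    have "T f \<in> wl2 G \<sigma>" using T f by (auto simp: bounded_op_def)
    then have "cmod (T f v) \<le> sqrt ((\<sigma> v)\<^sup>2 * vsize G v) * wl2_norm G \<sigma> (T f)"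
      by (rule wl2_eval_le[where f="T f" and v=v and \<rho>=\<sigma>, OF _ v pos])
    also have "\<dots> \<le> sqrt ((\<sigma> v)\<^sup>2 * vsize G v) * (B * wl2_norm G \<rho> f)"
      by (intro mult_left_mono B f) (simp add: vsize_nonneg)
    finally show ?thesis by (simp add: mult.assoc)
  qed
  then show ?thesis using T
    by (auto simp: bounded_functional_def bounded_op_def cscale_def intro!: exI)
qed

text \<open>Finitely supported functions are dense: the part of \<open>f\<close> outside a large
  finite set has arbitrarily small norm.\<close>

lemma bounded_functional_eq_0:
  fixes \<Lambda> :: "('v \<Rightarrow> complex) \<Rightarrow> complex"
  assumes bf: "bounded_functional G \<rho> \<Lambda>"
    and delta: "\<And>y. y \<in> verts (ugraph G) \<Longrightarrow> \<Lambda> (delta y) = 0"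
    and f: "f \<in> wl2 G \<rho>"
  shows "\<Lambda> f = 0"
proof -
  obtain B where add: "\<And>f g. f \<in> wl2 G \<rho> \<Longrightarrow> g \<in> wl2 G \<rho> \<Longrightarrow> \<Lambda> (f + g) = \<Lambda> f + \<Lambda> g"
    and scale: "\<And>c f. f \<in> wl2 G \<rho> \<Longrightarrow> \<Lambda> (cscale c f) = c * \<Lambda> f"
    and bound: "\<And>f. f \<in> wl2 G \<rho> \<Longrightarrow> cmod (\<Lambda> f) \<le> B * wl2_norm G \<rho> f"
    using bf unfolding bounded_functional_def by blast
  define V where "V = verts (ugraph G)"
  define s where "s v = (cmod (f v))\<^sup>2 / ((\<rho> v)\<^sup>2 * vsize G v)" for v
  define cut where "cut S = (\<lambda>v. if v \<in> S then f v else 0)" for S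
  have cut: "cut S \<in> wl2 G \<rho>" for S
    by (rule wl2_dominated[OF f]) (auto simp: cut_def)
  have s: "s summable_on V" using wl2_summable[OF f] by (simp add: s_def[abs_def] V_def)
  have cut0: "\<Lambda> (cut S) = 0" if "finite S" "S \<subseteq> V" for S
    using that
  proof (induction S)
    case empty
    have "cut {} = cscale 0 (cut {})" by (auto simp: cut_def cscale_def)
    from arg_cong[OF this, of \<Lambda>] show ?case by (simp only: scale[OF cut] mult_zero_left)
  next
    case (insert y S)
    have "cut (insert y S) = cscale (f y) (delta y) + cut S"
      using insert by (auto simp: cut_def cscale_def delta_def fun_eq_iff)
    from arg_cong[OF this, of \<Lambda>] show ?case
      using insert by (simp only: add[OF wl2_cscale[OF delta_in_wl2] cut] scale[OF delta_in_wl2] delta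
          V_def insert_subset) simp
  qed
  \<comment> \<open>\<open>B\<close> may be negative, so the bound uses its absolute value.\<close>
  have "cmod (\<Lambda> f) \<le> \<bar>B\<bar> * sqrt e" if e: "e > 0" for e
  proof -
    have "(sum s \<longlongrightarrow> infsum s V) (finite_subsets_at_top V)"
      using has_sum_infsum[OF s] by (simp add: has_sum_def)
    then have "\<forall>\<^sub>F S in finite_subsets_at_top V. dist (sum s S) (infsum s V) < e"
      using e by (rule tendstoD)
    then obtain S where S: "finite S" "S \<subseteq> V" "dist (sum s S) (infsum s V) < e"
      unfolding eventually_finite_subsets_at_top by blast
    have eq: "f = cut S + cut (- S)" by (auto simp: cut_def fun_eq_iff)
    have "\<Lambda> f = \<Lambda> (cut (- S))"
      using arg_cong[OF eq, of \<Lambda>] add[OF cut cut] cut0[OF S(1,2)] by simp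
    moreover have "(wl2_norm G \<rho> (cut (- S)))\<^sup>2 \<le> e"
    proof -
      have "(wl2_norm G \<rho> (cut (- S)))\<^sup>2 = infsum s (V - S)"
        unfolding wl2_norm_square[OF cut]
        by (rule infsum_cong_neutral) (auto simp: cut_def s_def V_def)
      also have "\<dots> = infsum s V - sum s S"
        using S s by (subst infsum_Diff) (auto intro: summable_on_finite)
      also have "\<dots> \<le> e" using S(3) by (simp add: dist_real_def)
      finally show ?thesis .
    qed
    then have "wl2_norm G \<rho> (cut (- S)) \<le> sqrt e" by (rule real_le_rsqrt)
    then have "B * wl2_norm G \<rho> (cut (- S)) \<le> \<bar>B\<bar> * sqrt e"
      by (intro mult_mono) (auto simp: wl2_norm_nonneg)
    ultimately show ?thesis using bound[OF cut, of "- S"] by simp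
  qed
  note le = this
  show ?thesis
  proof (rule ccontr)
    assume "\<Lambda> f \<noteq> 0"
    \<comment> \<open>Makes the bound at most half of \<open>cmod (\<Lambda> f)\<close>; the summand
      1 covers \<open>B = 0\<close>.\<close>
    define e where "e = (cmod (\<Lambda> f) / (2 * (\<bar>B\<bar> + 1)))\<^sup>2"
    have "cmod (\<Lambda> f) \<le> \<bar>B\<bar> * sqrt e"
      by (rule le) (use \<open>\<Lambda> f \<noteq> 0\<close> in \<open>auto simp: e_def\<close>)
    also have "\<dots> = cmod (\<Lambda> f) * (\<bar>B\<bar> / (2 * (\<bar>B\<bar> + 1)))"
      by (simp add: e_def real_sqrt_abs abs_mult)
    also have "\<dots> \<le> cmod (\<Lambda> f) * (1 / 2)"
      by (intro mult_left_mono) (auto simp: field_simps)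
    finally show False using \<open>\<Lambda> f \<noteq> 0\<close> by simp
  qed
qed

section \<open>Scalar Laurent expansions of operator families\<close>

lemma holomorphic_family_eval:
  assumes hol: "holomorphic_family G \<rho> \<sigma> U T" and U: "open U" and f: "f \<in> wl2 G \<rho>"
    and v: "v \<in> verts (ugraph G)" and pos: "0 < (\<sigma> v)\<^sup>2 * vsize G v"
  shows "(\<lambda>\<mu>. T \<mu> f v) holomorphic_on U"
proof -
  define c where "c = sqrt ((\<sigma> v)\<^sup>2 * vsize G v)"
  have c: "c > 0" using pos by (simp add: c_def)
  have "\<exists>d. ((\<lambda>\<mu>. T \<mu> f v) has_field_derivative d) (at \<mu>)" if \<mu>: "\<mu> \<in> U" for \<mu>
  proof -
    obtain D where D: "bounded_op G \<rho> \<sigma> D"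
      and lim: "\<And>\<epsilon>. \<epsilon> > 0 \<Longrightarrow> \<forall>\<^sub>F \<nu> in at \<mu>. \<forall>f \<in> wl2 G \<rho>.
            wl2_norm G \<sigma> (cscale (1 / (\<nu> - \<mu>)) (T \<nu> f - T \<mu> f) - D f) \<le> \<epsilon> * wl2_norm G \<rho> f"
      using hol \<mu> unfolding holomorphic_family_def by blast
    have bdd: "bounded_op G \<rho> \<sigma> (T \<nu>)" if "\<nu> \<in> U" for \<nu>
      using hol that unfolding holomorphic_family_def by blast
    have "((\<lambda>\<nu>. (T \<nu> f v - T \<mu> f v) / (\<nu> - \<mu>)) \<longlongrightarrow> D f v) (at \<mu>)"
    proof (rule tendstoI)
      fix e :: real assume e: "e > 0"
      \<comment> \<open>Chosen so that the error at \<open>v\<close> is at most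
        \<open>e / 2\<close>; adding 1 covers \<open>f\<close> of norm zero.\<close>
      define \<epsilon> where "\<epsilon> = e / (2 * c * (wl2_norm G \<rho> f + 1))"
      have n: "wl2_norm G \<rho> f + 1 > 0" using wl2_norm_nonneg[of G \<rho> f] by simp
      then have "\<epsilon> > 0" using e c by (simp add: \<epsilon>_def)
      have "c * (\<epsilon> * wl2_norm G \<rho> f) = (e / 2) * (wl2_norm G \<rho> f / (wl2_norm G \<rho> f + 1))"
        using c by (simp add: \<epsilon>_def)
      also have "\<dots> \<le> (e / 2) * 1"
        using n e wl2_norm_nonneg[of G \<rho> f] by (intro mult_left_mono) auto
      finally have small: "c * (\<epsilon> * wl2_norm G \<rho> f) < e" using e by simp
      have "\<forall>\<^sub>F \<nu> in at \<mu>. \<nu> \<in> U" using U \<mu> by (rule eventually_at_in_open')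
      with lim[OF \<open>\<epsilon> > 0\<close>]
      show "\<forall>\<^sub>F \<nu> in at \<mu>. dist ((T \<nu> f v - T \<mu> f v) / (\<nu> - \<mu>)) (D f v) < e"
      proof eventually_elim
        case (elim \<nu>)
        define g where "g = cscale (1 / (\<nu> - \<mu>)) (T \<nu> f - T \<mu> f) - D f"
        have "g \<in> wl2 G \<sigma>"
          using bdd[OF elim(2)] bdd[OF \<mu>] D f unfolding g_def bounded_op_def
          by (intro wl2_diff wl2_cscale) auto
        then have "cmod (g v) \<le> c * wl2_norm G \<sigma> g"
          unfolding c_def by (rule wl2_eval_le[where f=g and v=v and \<rho>=\<sigma>, OF _ v pos])
        also have "\<dots> \<le> c * (\<epsilon> * wl2_norm G \<rho> f)"
          using elim(1) f c unfolding g_def by (intro mult_left_mono) auto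
        also note small
        finally show ?case by (simp add: g_def cscale_def dist_norm)
      qed
    qed
    then show ?thesis by (auto simp: has_field_derivative_iff)
  qed
  then show ?thesis
    using U by (auto simp: holomorphic_on_open)
qed

lemma fls_nth_sum: "fls_nth (sum F I) n = (\<Sum>i\<in>I. fls_nth (F i) n)"
  by (induction I rule: infinite_finite_induct) auto

lemma sum_fun_apply: "(\<Sum>i\<in>I. F i) x = (\<Sum>i\<in>I. F i x)" for F :: "'i \<Rightarrow> 'a \<Rightarrow> complex"
  by (induction I rule: infinite_finite_induct) auto

text \<open>Makes the uniqueness of scalar Laurent coefficients available for the
  \<open>C j\<close>. The zero for \<open>j > J\<close> is needed when a relation shifts indices
  beyond \<open>J\<close>.\<close>

lemma principal_part_laurent:
  assumes pp: "has_principal_part G \<rho> \<sigma> R \<mu>\<^sub>0 J C" and f: "f \<in> wl2 G \<rho>"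
    and v: "v \<in> verts (ugraph G)" and pos: "0 < (\<sigma> v)\<^sup>2 * vsize G v"
  shows "\<exists>U. (\<lambda>w. R (\<mu>\<^sub>0 + w) f v) has_laurent_expansion U \<and>
    (\<forall>j\<ge>1. fls_nth U (- int j) = (if j \<le> J then C j f v else 0))"
proof -
  obtain r Rhol where r: "r > 0" and hol: "holomorphic_family G \<rho> \<sigma> (ball \<mu>\<^sub>0 r) Rhol"
    and R: "\<And>\<mu>. \<mu> \<in> ball \<mu>\<^sub>0 r - {\<mu>\<^sub>0} \<Longrightarrow>
       R \<mu> f = (\<Sum>j = 1..J. cscale (1 / (\<mu> - \<mu>\<^sub>0) ^ j) (C j f)) + Rhol \<mu> f"
    using pp f unfolding has_principal_part_def by blast
  define H where "H = fps_expansion (\<lambda>\<mu>. Rhol \<mu> f v) \<mu>\<^sub>0"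
  have "(\<lambda>\<mu>. Rhol \<mu> f v) holomorphic_on ball \<mu>\<^sub>0 r"
    by (rule holomorphic_family_eval[where \<sigma>=\<sigma>, OF hol _ f v pos]) auto
  then have "(\<lambda>\<mu>. Rhol \<mu> f v) analytic_on {\<mu>\<^sub>0}"
    using r by (auto simp: analytic_at intro!: exI[of _ "ball \<mu>\<^sub>0 r"])
  then have H: "(\<lambda>w. Rhol (\<mu>\<^sub>0 + w) f v) has_laurent_expansion fps_to_fls H"
    unfolding H_def by (intro has_laurent_expansion_fps analytic_at_imp_has_fps_expansion)
  define U where "U = (\<Sum>j = 1..J. fls_const (C j f v) * fls_X_intpow (- int j)) + fps_to_fls H"
  have "(\<lambda>w. (\<Sum>j = 1..J. C j f v * w powi (- int j)) + Rhol (\<mu>\<^sub>0 + w) f v) has_laurent_expansion U"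
    unfolding U_def by (intro laurent_expansion_intros H)
  moreover have "\<forall>\<^sub>F w in at 0. R (\<mu>\<^sub>0 + w) f v = (\<Sum>j = 1..J. C j f v * w powi (- int j)) + Rhol (\<mu>\<^sub>0 + w) f v"
  proof -
    have "\<forall>\<^sub>F w in at 0. w \<in> ball 0 r - {0::complex}"
      using r by (intro eventually_at_in_open) auto
    then show ?thesis
    proof eventually_elim
      case (elim w)
      have "R (\<mu>\<^sub>0 + w) f = (\<Sum>j = 1..J. cscale (1 / (\<mu>\<^sub>0 + w - \<mu>\<^sub>0) ^ j) (C j f)) + Rhol (\<mu>\<^sub>0 + w) f"
        by (rule R) (use elim in \<open>auto simp: dist_norm\<close>)
      from fun_cong[OF this, of v] show ?case
        by (simp only: plus_fun_apply sum_fun_apply cscale_def) (simp add: power_int_minus field_simps)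
    qed
  qed
  ultimately have "(\<lambda>w. R (\<mu>\<^sub>0 + w) f v) has_laurent_expansion U"
    by (subst has_laurent_expansion_cong) auto
  moreover have "fls_nth U (- int j) = (if j \<le> J then C j f v else 0)" if "j \<ge> 1" for j
  proof -
    have "fls_nth U (- int j) = (\<Sum>i = 1..J. C i f v * (if i = j then 1 else 0))"
      using that unfolding U_def by (auto simp: fls_nth_sum intro!: sum.cong)
    also have "\<dots> = (\<Sum>i = 1..J. if i = j then C i f v else 0)"
      by (intro sum.cong) auto
    finally have "fls_nth U (- int j) = (\<Sum>i = 1..J. if i = j then C i f v else 0)" .
    then show ?thesis using that by simp
  qed
  ultimately show ?thesis by blast
qed

lemma poly_analytic: "poly p analytic_on (A :: complex set)"
proof -
  have "poly p holomorphic_on UNIV"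
    by (auto simp: holomorphic_on_def field_differentiable_def intro!: exI poly_DERIV)
  then have "poly p analytic_on UNIV" by (simp add: analytic_on_open)
  then show ?thesis by (rule analytic_on_subset) simp
qed

text \<open>Near \<open>\<mu>\<^sub>0\<close> the polynomial is \<open>w ^ k\<close> times a
  nonvanishing factor, \<open>k\<close> being the order of the root, so \<open>u\<close> has a pole
  of order at most \<open>k\<close>.\<close>

lemma polynomial_multiple_regular:
  fixes p :: "complex poly"
  assumes p: "p \<noteq> 0" and U: "u has_laurent_expansion U" and H: "h has_fps_expansion H"
    and eq: "\<forall>\<^sub>F w in at 0. poly p (\<mu>\<^sub>0 + w) * u w = h w"
    and j: "j > Polynomial.order \<mu>\<^sub>0 p"
  shows "fls_nth U (- int j) = 0"
proof -
  define k where "k = Polynomial.order \<mu>\<^sub>0 p"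
  obtain s where s: "p = [:- \<mu>\<^sub>0, 1:] ^ k * s" "\<not> [:- \<mu>\<^sub>0, 1:] dvd s"
    using order_decomp[OF p] unfolding k_def by blast
  then have s0: "poly s \<mu>\<^sub>0 \<noteq> 0" by (simp add: poly_eq_0_iff_dvd)
  define S where "S = fps_expansion (\<lambda>w. poly s w) \<mu>\<^sub>0"
  have S: "(\<lambda>w. poly s (\<mu>\<^sub>0 + w)) has_fps_expansion S"
    unfolding S_def by (intro analytic_at_imp_has_fps_expansion poly_analytic)
  then have S0: "fps_nth S 0 \<noteq> 0"
    using s0 by (auto dest: has_fps_expansion_imp_0_eq_fps_nth_0)
  then have subS: "fls_subdegree (fps_to_fls S) = 0" "S \<noteq> 0"
    by (auto simp: fls_subdegree_fls_to_fps)
  have "(\<lambda>w. w ^ k * poly s (\<mu>\<^sub>0 + w) * u w) has_laurent_expansion fls_X_intpow k * fps_to_fls S * U"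
    by (intro laurent_expansion_intros U has_laurent_expansion_fps S)
  moreover have "\<forall>\<^sub>F w in at 0. w ^ k * poly s (\<mu>\<^sub>0 + w) * u w = h w"
    using eq by eventually_elim (simp add: s(1) poly_power)
  ultimately have "h has_laurent_expansion fls_X_intpow k * fps_to_fls S * U"
    by (subst (asm) has_laurent_expansion_cong) auto
  then have eq: "fls_X_intpow k * fps_to_fls S * U = fps_to_fls H"
    using has_laurent_expansion_unique has_laurent_expansion_fps[OF H] by blast
  show ?thesis
  proof (cases "U = 0")
    case False
    have "int k + fls_subdegree U = fls_subdegree (fls_X_intpow (int k) * fps_to_fls S * U)"
      using False subS by (simp add: fls_subdegree_mult)
    also have "\<dots> \<ge> 0" unfolding eq by (rule fls_subdegree_fls_to_fps_gt0)
    finally show ?thesis using j by (intro fls_eq0_below_subdegree) (simp add: k_def)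
  qed simp
qed

text \<open>Shifting by \<open>n\<close> reduces the claim to the Cauchy product of power series.
  The range \<open>k < n\<close> is the same for all \<open>j\<close>; this later makes
  \<open>n\<close> functions per core vertex suffice.\<close>

lemma fls_nth_fps_times:
  fixes a :: "complex fps" and U :: "complex fls"
  assumes zero: "\<And>i. i > n \<Longrightarrow> fls_nth U (- int i) = 0" and j: "j \<ge> 1"
  shows "fls_nth (fps_to_fls a * U) (- int j) = (\<Sum>k<n. fps_nth a k * fls_nth U (- int (j + k)))"
proof -
  define s where "s = fls_shift (- int n) U"
  have "fls_nth s k = 0" if "k < 0" for k
    using zero[of "nat (int n - k)"] that by (simp add: s_def)
  then have s: "fps_to_fls (fls_regpart s) = s"
    by (intro fls_regpart_to_fls_trivial fls_subdegree_ge0I)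
  have "fps_to_fls a * U = fls_shift (int n) (fps_to_fls a * fps_to_fls (fls_regpart s))"
    unfolding s by (simp add: s_def fls_shifted_times_simps)
  also have "\<dots> = fls_shift (int n) (fps_to_fls (a * fls_regpart s))"
    by (simp add: fls_times_fps_to_fls)
  finally have eq: "fls_nth (fps_to_fls a * U) (- int j) = fls_nth (fps_to_fls (a * fls_regpart s)) (int n - int j)"
    by simp
  show ?thesis
  proof (cases "j \<le> n")
    case True
    have "fls_nth (fps_to_fls a * U) (- int j) = (\<Sum>k = 0..n - j. fps_nth a k * fls_nth U (- int (j + k)))"
      unfolding eq using True by (auto simp: fps_mult_nth s_def nat_diff_distrib algebra_simps intro!: sum.cong)
    \<comment> \<open>The added terms have \<open>j + k > n\<close> and vanish;
      \<open>j \<ge> 1\<close> ensures \<open>n - j < n\<close>.\<close>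
    also have "\<dots> = (\<Sum>k<n. fps_nth a k * fls_nth U (- int (j + k)))"
      using j True zero by (intro sum.mono_neutral_left) (auto simp del: of_nat_add)
    finally show ?thesis .
  next
    case False
    then show ?thesis unfolding eq using zero by (auto intro!: sum.neutral simp del: of_nat_add)
  qed
qed

section \<open>Continuation from large |\<mu>|\<close>

text \<open>Identity theorem on the connected exterior of a disc. The conclusion concerns a
  punctured neighbourhood, as the value of a meromorphic function at an isolated point is
  arbitrary.\<close>

lemma meromorphic_continuation_eq_0:
  assumes mero: "F meromorphic_on {\<mu>. r < cmod \<mu>}" and F0: "\<And>\<mu>. M < cmod \<mu> \<Longrightarrow> F \<mu> = 0"
    and \<mu>\<^sub>0: "r < cmod \<mu>\<^sub>0"
  shows "\<forall>\<^sub>F \<mu> in at \<mu>\<^sub>0. F \<mu> = 0"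
proof -
  let ?A = "{\<mu>. r < cmod \<mu>}"
  have open_gt: "open {\<mu>. s < cmod \<mu>}" for s
    by (intro open_Collect_less continuous_intros)
  have "?A = - cball 0 r" by (auto simp: dist_norm)
  then have "Topological_Spaces.connected ?A" by (simp add: connected_complement_bounded_convex)
  with mero open_gt consider "\<forall>\<^sub>\<approx>\<mu>\<in>?A. F \<mu> = 0" | "\<forall>\<^sub>\<approx>\<mu>\<in>?A. F \<mu> \<noteq> 0"
    using meromorphic_imp_constant_or_avoid by blast
  then show ?thesis
  proof cases
    case 1
    then show ?thesis using \<mu>\<^sub>0 open_gt by (auto simp: eventually_cosparse_open_eq)
  next
    case 2
    define s where "s = max \<bar>r\<bar> \<bar>M\<bar> + 1"
    have s: "r < cmod (of_real s)" "M < cmod (of_real s)" by (auto simp: s_def)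
    then have "\<forall>\<^sub>F \<mu> in at (of_real s). F \<mu> \<noteq> 0"
      using 2 open_gt by (auto simp: eventually_cosparse_open_eq)
    moreover have "\<forall>\<^sub>F \<mu> in at (of_real s). \<mu> \<in> {\<mu>. M < cmod \<mu>}"
      using s open_gt by (intro eventually_at_in_open') auto
    ultimately have "\<forall>\<^sub>F \<mu> in at (complex_of_real s). False"
      by eventually_elim (use F0 in auto)
    then show ?thesis by simp
  qed
qed

lemma holomorphic_laurent:
  assumes "f holomorphic_on - {0}" "\<mu>\<^sub>0 \<noteq> 0"
  shows "(\<lambda>w. f (\<mu>\<^sub>0 + w)) has_fps_expansion fps_expansion f \<mu>\<^sub>0"
proof -
  have "f analytic_on {\<mu>\<^sub>0}"
    using assms by (auto simp: analytic_at intro!: exI[of _ "- {0}"])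
  then show ?thesis by (rule analytic_at_imp_has_fps_expansion)
qed

text \<open>\<open>core\<close> and \<open>ends\<close> concern only point sources and |\<mu>| > 1;
  meromorphic continuation carries them to \<open>\<mu>\<^sub>0\<close>. As \<open>h\<close> and
  \<open>k\<close> are holomorphic off 0, \<open>h\<close> bounds the pole order on the core, while
  \<open>k\<close> drops out of the negative Laurent coefficients.\<close>

lemma resolvent_principal_part_formula:
  fixes p :: "complex poly" and G :: "('v, 'e, 'g, 'h) gog"
  defines "V \<equiv> verts (ugraph G)"
  assumes q: "q \<ge> 2" and vsize: "\<And>v. v \<in> V \<Longrightarrow> vsize G v > 0"
    and LV: "L \<subseteq> V" and t: "\<And>x. x \<in> V \<Longrightarrow> t x \<in> L" and p: "p \<noteq> 0"
    and a: "\<And>x. x \<in> V \<Longrightarrow> a x holomorphic_on - {0}"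
    and h: "\<And>y v. y \<in> V \<Longrightarrow> v \<in> L \<Longrightarrow> h y v holomorphic_on - {0}"
    and k: "\<And>y x. y \<in> V \<Longrightarrow> x \<in> V \<Longrightarrow> k y x holomorphic_on - {0}"
    and core: "\<And>\<mu> u y v. cmod \<mu> > 1 \<Longrightarrow> u \<in> ell2 G \<Longrightarrow> shifted_adjacency G q \<mu> u = delta y \<Longrightarrow>
      y \<in> V \<Longrightarrow> v \<in> L \<Longrightarrow> poly p \<mu> * u v = h y v \<mu>"
    and ends: "\<And>\<mu> u y x. cmod \<mu> > 1 \<Longrightarrow> u \<in> ell2 G \<Longrightarrow> shifted_adjacency G q \<mu> u = delta y \<Longrightarrow>
      y \<in> V \<Longrightarrow> x \<in> V \<Longrightarrow> u x = a x \<mu> * u (t x) + k y x \<mu>"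
    and pp: "resolvent_principal_part G q b \<mu>\<^sub>0 N J C" and \<mu>\<^sub>0: "\<mu>\<^sub>0 \<noteq> 0"
    and f: "f \<in> wl2 G (exp_weight G q b (- N))" and j: "j \<in> {1..J}" and x: "x \<in> V"
  shows "C j f x = (\<Sum>i<Polynomial.order \<mu>\<^sub>0 p.
    fps_nth (fps_expansion (a x) \<mu>\<^sub>0) i * (if j + i \<le> J then C (j + i) f (t x) else 0))"
proof -
  define \<rho> where "\<rho> = exp_weight G q b (- N)"
  define \<sigma> where "\<sigma> = exp_weight G q b N"
  define r where "r = real q powr (1/2 - N)"
  define n where "n = Polynomial.order \<mu>\<^sub>0 p"
  obtain R where cont: "resolvent_continuation G q b N R"
    and R: "has_principal_part G \<rho> \<sigma> R \<mu>\<^sub>0 J C" and N: "N \<ge> 0" and r\<mu>\<^sub>0: "r < cmod \<mu>\<^sub>0"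
    using pp unfolding resolvent_principal_part_def \<rho>_def \<sigma>_def r_def by blast
  have r0: "r > 0" using q by (simp add: r_def)
  have pos: "0 < (\<sigma> v)\<^sup>2 * vsize G v" if "v \<in> V" for v
    using q vsize[OF that] by (simp add: \<sigma>_def exp_weight_def)
  have mero: "finitely_meromorphic G \<rho> \<sigma> {\<mu>. cmod \<mu> > r} R"
    using cont unfolding resolvent_continuation_def \<rho>_def \<sigma>_def r_def by blast
  obtain M where M: "\<And>\<mu>. cmod \<mu> > M \<Longrightarrow> bij_betw (shifted_adjacency G q \<mu>) (ell2 G) (ell2 G)"
    "\<And>\<mu> f. cmod \<mu> > M \<Longrightarrow> f \<in> wl2 G \<rho> \<Longrightarrow> R \<mu> f = resolvent G q \<mu> f"
    using cont unfolding resolvent_continuation_def \<rho>_def by blast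
  \<comment> \<open>For large \<mu> the continuation is the true resolvent, so its values lie in
    \<open>ell2 G\<close> and not just in the weighted target space.\<close>
  have Rdelta: "R \<mu> (delta y) \<in> ell2 G" "shifted_adjacency G q \<mu> (R \<mu> (delta y)) = delta y"
    if "y \<in> V" "cmod \<mu> > M" for \<mu> y
  proof -
    have "delta y \<in> ell2 G" "delta y \<in> wl2 G \<rho>" using that by (auto simp: delta_in_wl2 V_def)
    with M[OF that(2)] show "R \<mu> (delta y) \<in> ell2 G" "shifted_adjacency G q \<mu> (R \<mu> (delta y)) = delta y"
      by (auto simp: resolvent_def bij_betw_def inv_into_into f_inv_into_f)
  qed
  have merofun: "(\<lambda>\<mu>. R \<mu> (delta y) v) meromorphic_on {\<mu>. r < cmod \<mu>}" if "y \<in> V" "v \<in> V" for y v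
    unfolding meromorphic_on_def
  proof
    fix \<mu>\<^sub>1 assume "\<mu>\<^sub>1 \<in> {\<mu>. r < cmod \<mu>}"
    then obtain J' C' where "has_principal_part G \<rho> \<sigma> R \<mu>\<^sub>1 J' C'"
      using mero unfolding finitely_meromorphic_def by blast
    from principal_part_laurent[where \<sigma>=\<sigma> and v=v, OF this delta_in_wl2 _ pos] that
    show "\<exists>F. (\<lambda>w. R (\<mu>\<^sub>1 + w) (delta y) v) has_laurent_expansion F" by (auto simp: V_def)
  qed
  have holmero: "g meromorphic_on {\<mu>. r < cmod \<mu>}" if "g holomorphic_on - {0}" for g
  proof -
    have "g analytic_on - {0}" using that by (simp add: analytic_on_open open_Compl)
    then have "g analytic_on {\<mu>. r < cmod \<mu>}" by (rule analytic_on_subset) (use r0 in auto)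
    then show ?thesis by (rule analytic_on_imp_meromorphic_on)
  qed
  have polymero: "poly p meromorphic_on A" for A
    by (intro analytic_on_imp_meromorphic_on poly_analytic)
  have at0: "(\<forall>\<^sub>F \<mu> in at \<mu>\<^sub>0. P \<mu>) \<longleftrightarrow> (\<forall>\<^sub>F w in at 0. P (\<mu>\<^sub>0 + w))" for P
    unfolding at_to_0[of \<mu>\<^sub>0] eventually_filtermap by (simp only: add.commute)
  have core': "\<forall>\<^sub>F w in at 0. poly p (\<mu>\<^sub>0 + w) * R (\<mu>\<^sub>0 + w) (delta y) v = h y v (\<mu>\<^sub>0 + w)"
    if "y \<in> V" "v \<in> L" for y v
  proof -
    have "\<forall>\<^sub>F \<mu> in at \<mu>\<^sub>0. poly p \<mu> * R \<mu> (delta y) v - h y v \<mu> = 0"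
    \<comment> \<open>1 is the threshold of \<open>core\<close>, and \<open>M\<close> that of
      \<open>Rdelta\<close>.\<close>
    proof (rule meromorphic_continuation_eq_0[where r=r and M="max 1 M"])
      show "(\<lambda>\<mu>. poly p \<mu> * R \<mu> (delta y) v - h y v \<mu>) meromorphic_on {\<mu>. r < cmod \<mu>}"
        using that LV by (intro meromorphic_intros polymero merofun holmero h) auto
    qed (use that core Rdelta r\<mu>\<^sub>0 in auto)
    then show ?thesis unfolding at0 by simp
  qed
  have ends': "\<forall>\<^sub>F w in at 0. R (\<mu>\<^sub>0 + w) (delta y) x =
      a x (\<mu>\<^sub>0 + w) * R (\<mu>\<^sub>0 + w) (delta y) (t x) + k y x (\<mu>\<^sub>0 + w)" if y: "y \<in> V" for y
  proof -
    have "\<forall>\<^sub>F \<mu> in at \<mu>\<^sub>0. R \<mu> (delta y) x - (a x \<mu> * R \<mu> (delta y) (t x) + k y x \<mu>) = 0"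
    proof (rule meromorphic_continuation_eq_0[where r=r and M="max 1 M"])
      show "(\<lambda>\<mu>. R \<mu> (delta y) x - (a x \<mu> * R \<mu> (delta y) (t x) + k y x \<mu>)) meromorphic_on {\<mu>. r < cmod \<mu>}"
        using y x t[OF x] LV by (intro meromorphic_intros merofun holmero a k) auto
    next
      fix \<mu> assume "max 1 M < cmod \<mu>"
      then show "R \<mu> (delta y) x - (a x \<mu> * R \<mu> (delta y) (t x) + k y x \<mu>) = 0"
        using ends[OF _ Rdelta y x, of \<mu>] y by auto
    qed (use r\<mu>\<^sub>0 in auto)
    then show ?thesis unfolding at0 by simp
  qed
  have delta_formula: "C j (delta y) x = (\<Sum>i<n.
      fps_nth (fps_expansion (a x) \<mu>\<^sub>0) i * (if j + i \<le> J then C (j + i) (delta y) (t x) else 0))"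
    if y: "y \<in> V" for y
  proof -
    have dy: "delta y \<in> wl2 G \<rho>" and tx: "t x \<in> V"
      using y x t LV by (auto simp: delta_in_wl2 V_def)
    obtain U where U: "(\<lambda>w. R (\<mu>\<^sub>0 + w) (delta y) x) has_laurent_expansion U"
      "\<And>j. j \<ge> 1 \<Longrightarrow> fls_nth U (- int j) = (if j \<le> J then C j (delta y) x else 0)"
      using principal_part_laurent[where \<sigma>=\<sigma> and v=x, OF R dy _ pos[OF x]] x by (auto simp: V_def)
    obtain W where W: "(\<lambda>w. R (\<mu>\<^sub>0 + w) (delta y) (t x)) has_laurent_expansion W"
      "\<And>j. j \<ge> 1 \<Longrightarrow> fls_nth W (- int j) = (if j \<le> J then C j (delta y) (t x) else 0)"
      using principal_part_laurent[where \<sigma>=\<sigma> and v="t x", OF R dy _ pos[OF tx]] tx by (auto simp: V_def)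
    \<comment> \<open>\<open>t x\<close> lies in the core, where multiplication by \<open>p\<close>
      removes the pole.\<close>
    have "fls_nth W (- int i) = 0" if "i > n" for i
      using polynomial_multiple_regular[OF p W(1) holomorphic_laurent[OF h[OF y t[OF x]] \<mu>\<^sub>0]
          core'[OF y t[OF x]]] that by (simp add: n_def)
    note conv = fls_nth_fps_times[OF this, where j=j and a="fps_expansion (a x) \<mu>\<^sub>0"]
    have "(\<lambda>w. a x (\<mu>\<^sub>0 + w) * R (\<mu>\<^sub>0 + w) (delta y) (t x) + k y x (\<mu>\<^sub>0 + w)) has_laurent_expansion
        fps_to_fls (fps_expansion (a x) \<mu>\<^sub>0) * W + fps_to_fls (fps_expansion (k y x) \<mu>\<^sub>0)"
      by (intro laurent_expansion_intros has_laurent_expansion_fps holomorphic_laurent a k x y \<mu>\<^sub>0 W(1))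
    then have "(\<lambda>w. R (\<mu>\<^sub>0 + w) (delta y) x) has_laurent_expansion
        fps_to_fls (fps_expansion (a x) \<mu>\<^sub>0) * W + fps_to_fls (fps_expansion (k y x) \<mu>\<^sub>0)"
      by (subst has_laurent_expansion_cong[OF ends'[OF y] refl])
    from has_laurent_expansion_unique[OF U(1) this]
    have "C j (delta y) x = fls_nth (fps_to_fls (fps_expansion (a x) \<mu>\<^sub>0) * W) (- int j)"
      using U(2)[of j] j by simp
    also have "\<dots> = (\<Sum>i<n. fps_nth (fps_expansion (a x) \<mu>\<^sub>0) i * fls_nth W (- int (j + i)))"
      using conv j by simp
    also have "\<dots> = (\<Sum>i<n.
      fps_nth (fps_expansion (a x) \<mu>\<^sub>0) i * (if j + i \<le> J then C (j + i) (delta y) (t x) else 0))"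
      using j by (intro sum.cong refl arg_cong2[where f="(*)"] W(2)) auto
    finally show ?thesis .
  qed
  \<comment> \<open>The difference of the two sides as a functional of \<open>f\<close>: zero on
    point sources, hence everywhere. The form \<open>+ (- 1) *\<close> fits the closure
    rules.\<close>
  define \<Lambda> where "\<Lambda> f = C j f x + (- 1) * (\<Sum>i<n.
    fps_nth (fps_expansion (a x) \<mu>\<^sub>0) i * (if j + i \<le> J then C (j + i) f (t x) else 0))" for f
  have bop: "bounded_op G \<rho> \<sigma> (C i)" if "i \<in> {1..J}" for i
    using R that unfolding has_principal_part_def by blast
  \<comment> \<open>Boundedness of \<open>C i\<close> is known for \<open>i \<in> {1..J}\<close>
    only; beyond \<open>J\<close> the functional is 0.\<close>
  have "bounded_functional G \<rho> (\<lambda>f. if j + i \<le> J then C (j + i) f (t x) else 0)" for i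
    using j t[OF x] LV bounded_functional_eval[where \<sigma>=\<sigma> and v="t x", OF bop _ pos]
    by (cases "j + i \<le> J") (auto simp: V_def intro: bounded_functional_0)
  then have "bounded_functional G \<rho> \<Lambda>"
    unfolding \<Lambda>_def using x j
    by (intro bounded_functional_add bounded_functional_mult bounded_functional_sum
        bounded_functional_eval[where \<sigma>=\<sigma>, OF bop _ pos]) (auto simp: V_def)
  then have "\<Lambda> f = 0"
    by (rule bounded_functional_eq_0) (use f delta_formula in \<open>auto simp: \<Lambda>_def V_def \<rho>_def\<close>)
  then show ?thesis by (simp add: \<Lambda>_def n_def)
qed

section \<open>Rooted ends\<close>

lemma (in bidirected_digraph) awalk_rev:
  "awalk u p v \<Longrightarrow> awalk v (rev (map arev p)) u"
proof (induction p arbitrary: u)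
  case (Cons e p)
  then have "e \<in> arcs G" "u = tail G e" "awalk v (rev (map arev p)) (head G e)"
    by (auto simp: awalk_Cons_iff)
  moreover from this have "awalk (head G e) [arev e] u"
    by (simp add: awalk_simps)
  ultimately show ?case by (auto intro: awalk_appendI)
qed (simp add: awalk_Nil_iff)

lemma (in bidirected_digraph) awalk_rev_verts:
  assumes "awalk u p v"
  shows "set (pre_digraph.awalk_verts G v (rev (map arev p))) = set (pre_digraph.awalk_verts G u p)"
proof -
  have "v \<in> set (awalk_verts u p)" "u \<in> set (awalk_verts v (rev (map arev p)))"
    using assms awalk_rev[OF assms] by auto
  moreover have "set p \<subseteq> arcs G" using assms by auto
  then have "tail G ` arev ` set p = head G ` set p" "head G ` arev ` set p = tail G ` set p"
    by (force simp: image_iff subset_iff)+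
  ultimately show ?thesis
    using set_awalk_verts[OF assms] set_awalk_verts[OF awalk_rev[OF assms]] by auto
qed

text \<open>
  In a tree, a path from the head of an arc back to its tail closes up to a cycle, so it is the
  reversed arc.  Hence two in-arcs of a vertex cannot both come from vertices that are joined by
  a walk avoiding it.
\<close>

locale walk_tree = bidirected_digraph +
  assumes cycle_back: "cycle p \<Longrightarrow> \<exists>e. p = [e, arev e]"
begin

lemma apath_back:
  assumes "e \<in> arcs G" "apath (head G e) p (tail G e)"
  shows "p = [arev e]"
proof -
  have "awalk (tail G e) (e # p) (tail G e)"
    using assms by (auto simp: awalk_Cons_iff apath_def)
  then have "cycle (e # p)"
    using assms(2) unfolding cycle_def apath_def by (intro exI[of _ "tail G e"]) simp
  from cycle_back[OF this] show ?thesis by auto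
qed

text \<open>For a loop the empty path leads from head back to tail, but it is not the reversed
  arc.\<close>

lemma no_loop:
  assumes "e \<in> arcs G"
  shows "tail G e \<noteq> head G e"
proof
  assume eq: "tail G e = head G e"
  have "apath (head G e) [] (tail G e)"
    using assms by (simp add: apath_Nil_iff eq)
  from apath_back[OF assms this] show False by simp
qed

lemma in_arcs_eq_if_joined:
  assumes e: "e\<^sub>1 \<in> in_arcs G w" "e\<^sub>2 \<in> in_arcs G w"
    and p: "awalk (tail G e\<^sub>1) p (tail G e\<^sub>2)" "w \<notin> set (awalk_verts (tail G e\<^sub>1) p)"
  shows "e\<^sub>1 = e\<^sub>2"
proof -
  \<comment> \<open>Shortening to a path uses only arcs of \<open>p\<close>, so \<open>w\<close> is
    still avoided, and appending the arc \<open>e\<^sub>2\<close> into \<open>w\<close> keeps it a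
    path.\<close>
  define p' where "p' = awalk_to_apath p"
  have p': "apath (tail G e\<^sub>1) p' (tail G e\<^sub>2)"
    unfolding p'_def by (rule apath_awalk_to_apath[OF p(1)])
  have "set p' \<subseteq> set p"
    unfolding p'_def by (rule awalk_to_apath_subset[OF p(1)])
  then have "set (awalk_verts (tail G e\<^sub>1) p') \<subseteq> set (awalk_verts (tail G e\<^sub>1) p)"
    unfolding set_awalk_verts[OF p(1)] set_awalk_verts[OF awalkI_apath[OF p']] by auto
  then have w: "w \<notin> set (awalk_verts (tail G e\<^sub>1) p')" using p(2) by auto
  have aw: "awalk (tail G e\<^sub>1) (p' @ [e\<^sub>2]) w"
    using p' e(2) by (auto simp: apath_def awalk_simps intro!: awalk_appendI)
  have "awalk_verts (tail G e\<^sub>1) (p' @ [e\<^sub>2]) = awalk_verts (tail G e\<^sub>1) p' @ [w]"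
    using awalk_verts_append[OF aw] e(2) by simp
  then have "apath (tail G e\<^sub>1) (p' @ [e\<^sub>2]) w"
    using aw p' w by (simp add: apath_def)
  \<comment> \<open>Seen from \<open>arev e\<^sub>1\<close>, which starts at \<open>w\<close>, this
    path leads from its head back to its tail.\<close>
  then have "apath (head G (arev e\<^sub>1)) (p' @ [e\<^sub>2]) (tail G (arev e\<^sub>1))"
    using e(1) by simp
  then have "p' @ [e\<^sub>2] = [arev (arev e\<^sub>1)]"
    using e(1) by (intro apath_back) auto
  then show ?thesis by simp
qed

end

text \<open>
  \<open>up w\<close> is the arc into \<open>w\<close> from its parent; at the root it is the prong.
\<close>

definition rooted_piece ::
  "('v, 'e, 'g, 'h) gog \<Rightarrow> 'v \<Rightarrow> 'e \<Rightarrow> ('v \<Rightarrow> 'e) \<Rightarrow> ('v \<Rightarrow> nat) \<Rightarrow> bool" where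
  "rooted_piece P r h up ht \<longleftrightarrow>
     r \<in> verts (ugraph P) \<and> prongs P = {h} \<and> head (ugraph P) h = r \<and> up r = h \<and>
     (\<forall>w \<in> verts (ugraph P) - {r}. up w \<in> in_arcs (ugraph P) w \<and>
        ht (tail (ugraph P) (up w)) < ht w) \<and>
     (\<forall>w \<in> verts (ugraph P). in_arcs (ugraph P) w =
        (if w = r then {} else {up w}) \<union>
        (\<lambda>c. flip P (up c)) ` {c \<in> verts (ugraph P) - {r}. tail (ugraph P) (up c) = w})"

section \<open>Funnels and cusps as rooted pieces\<close>

lemma order_iso: "f \<in> iso A B \<Longrightarrow> Coset.order A = Coset.order B"
  by (auto simp: iso_def Coset.order_def dest: bij_betw_same_card)

context graph_of_groups_with_boundary
begin

sublocale bidirected_digraph "ugraph G" "flip G"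
  by (rule bidirected)

lemma vsize_pos: "v \<in> verts (ugraph G) \<Longrightarrow> vsize G v > 0"
  using vertex_group[of v] group.is_monoid monoid.one_closed[of "vgroup G v"]
  by (auto simp: vsize_def Coset.order_def card_gt_0_iff)

lemma esize_pos: "e \<in> arcs (ugraph G) \<union> prongs G \<Longrightarrow> esize G e > 0"
  using edge_group[of e] group.is_monoid monoid.one_closed[of "egroup G e"]
  by (auto simp: esize_def Coset.order_def card_gt_0_iff)

lemma esize_flip: "e \<in> arcs (ugraph G) \<Longrightarrow> esize G (flip G e) = esize G e"
  by (simp add: esize_def edge_group_flip)

text \<open>At the root the prong takes the place of the arc from the parent; with
  \<open>up r = h\<close> the formula is uniform.\<close>

lemma rooted_piece_degree:
  assumes rp: "rooted_piece G r h up ht" and w: "w \<in> verts (ugraph G)"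
  defines "Ch \<equiv> {c \<in> verts (ugraph G) - {r}. tail (ugraph G) (up c) = w}"
  shows "finite Ch" "degree G w = vsize G w / esize G (up w) + (\<Sum>c\<in>Ch. vsize G w / esize G (up c))"
proof -
  let ?D = "ugraph G" and ?f = "\<lambda>c. flip G (up c)"
  have upc: "up c \<in> arcs ?D" "head ?D (up c) = c" if "c \<in> Ch" for c
    using rp that by (auto simp: rooted_piece_def Ch_def)
  have inj: "inj_on ?f Ch"
    by (rule inj_onI) (metis arev_eq_iff upc(2))
  have ins: "in_arcs ?D w = (if w = r then {} else {up w}) \<union> ?f ` Ch"
    using rp w unfolding rooted_piece_def Ch_def by blast
  have "finite (?f ` Ch)"
    by (rule finite_subset[OF _ locally_finite[OF w]]) (use ins in auto)
  then show fin: "finite Ch" using inj by (rule finite_imageD)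
  have prongs: "{h' \<in> prongs G. head ?D h' = w} = (if w = r then {up w} else {})"
    using rp by (auto simp: rooted_piece_def)
  \<comment> \<open>Otherwise \<open>w\<close> would be the parent of its own parent, against the
    heights; at the root, \<open>up w\<close> is a prong and not an arc.\<close>
  have "up w \<notin> ?f ` Ch"
  proof
    assume "up w \<in> ?f ` Ch"
    then obtain c where c: "c \<in> Ch" "up w = flip G (up c)" by auto
    then have arc: "up w \<in> arcs ?D" using upc by simp
    then have "w \<noteq> r" using rp prongs_not_arcs by (auto simp: rooted_piece_def)
    then have "ht (tail ?D (up w)) < ht w" using rp w by (auto simp: rooted_piece_def)
    moreover have "tail ?D (up w) = c" using c upc by simp
    moreover have "ht (tail ?D (up c)) < ht c" using rp c by (auto simp: rooted_piece_def Ch_def)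
    ultimately show False using c by (simp add: Ch_def)
  qed
  have "in_arcs ?D w \<union> {h' \<in> prongs G. head ?D h' = w} = insert (up w) (?f ` Ch)"
    unfolding ins prongs by auto
  then have "degree G w = vsize G w / esize G (up w) + (\<Sum>e\<in>?f ` Ch. vsize G w / esize G e)"
    using fin \<open>up w \<notin> ?f ` Ch\<close> by (simp add: degree_def)
  also have "(\<Sum>e\<in>?f ` Ch. vsize G w / esize G e) = (\<Sum>c\<in>Ch. vsize G w / esize G (up c))"
    unfolding sum.reindex[OF inj] by (intro sum.cong) (auto simp: esize_flip upc)
  finally show "degree G w = vsize G w / esize G (up w) + (\<Sum>c\<in>Ch. vsize G w / esize G (up c))" .
qed

end

text \<open>The group of a vertex is the edge group of its \<open>up\<close>, prong included. So in
  the degree of \<open>w\<close> the parent contributes 1 and the children contribute q, and each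
  summand reduces to the contribution \<open>vsize P w / esize P (up c)\<close> of a child.\<close>

lemma funnel_rooted:
  assumes funnel: "orbifold_funnel P" and deg: "\<forall>v \<in> verts (ugraph P). degree P v = real q + 1"
  shows "\<exists>r h up ht. rooted_piece P r h up ht \<and> (\<forall>w \<in> verts (ugraph P).
    (\<Sum>c\<in>{c \<in> verts (ugraph P) - {r}. tail (ugraph P) (up c) = w}.
       vsize P w * vsize P c / (esize P (up c))\<^sup>2) = real q)"
proof -
  let ?D = "ugraph P" and ?V = "verts (ugraph P)"
  have gog: "graph_of_groups_with_boundary P" and tree: "underlying_tree P"
    using funnel by (auto simp: orbifold_funnel_def)
  interpret graph_of_groups_with_boundary P by (rule gog)
  interpret walk_tree ?D "flip P"
    using tree by unfold_locales (auto simp: underlying_tree_def)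
  obtain r h where r: "r \<in> ?V" and h: "prongs P = {h}" "head ?D h = r"
      "emono P h \<in> iso (egroup P h) (vgroup P r)"
    and iso: "\<And>e. e \<in> arcs ?D \<Longrightarrow> gdist P r (tail ?D e) < gdist P r (head ?D e) \<Longrightarrow>
           emono P e \<in> iso (egroup P e) (vgroup P (head ?D e))"
    using funnel unfolding orbifold_funnel_def by blast
  define d where "d = gdist P r"
  have d_le: "d w \<le> length p" if "awalk r p w" for p w
    unfolding d_def gdist_def by (rule Least_le) (use that in auto)
  have d_walk: "\<exists>p. awalk r p w \<and> length p = d w" if "w \<in> ?V" for w
  proof -
    have "r \<rightarrow>\<^sup>*\<^bsub>?D\<^esub> w" using connected r that by (auto simp: strongly_connected_def)
    then obtain p where "awalk r p w" unfolding reachable_awalk ..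
    then show ?thesis
      unfolding d_def gdist_def
      by (intro LeastI[where P="\<lambda>n. \<exists>p. awalk r p w \<and> length p = n" and k="length p"]) blast
  qed
  \<comment> \<open>With non-strict inequalities this also rules out arcs between vertices at equal
    distance from the root: they would be equal to \<open>up w\<close>.\<close>
  have unique: "e\<^sub>1 = e\<^sub>2" if e: "e\<^sub>1 \<in> in_arcs ?D w" "e\<^sub>2 \<in> in_arcs ?D w"
    and le: "d (tail ?D e\<^sub>1) \<le> d w" "d (tail ?D e\<^sub>2) \<le> d w" for e\<^sub>1 e\<^sub>2 w
  proof -
    have avoid: "\<exists>p. awalk r p (tail ?D e) \<and> w \<notin> set (awalk_verts r p)"
      if e: "e \<in> in_arcs ?D w" and le: "d (tail ?D e) \<le> d w" for e
    proof -
      obtain p where p: "awalk r p (tail ?D e)" "length p = d (tail ?D e)"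
        using d_walk[of "tail ?D e"] e by auto
      \<comment> \<open>If the shortest walk met \<open>w\<close>, it would have to stop there, and
        \<open>e\<close> would be a loop.\<close>
      have "w \<notin> set (awalk_verts r p)"
      proof
        assume "w \<in> set (awalk_verts r p)"
        then obtain p1 p2 where p12: "p = p1 @ p2" "awalk r p1 w" "awalk w p2 (tail ?D e)"
          using awalk_decomp[OF p(1)] by blast
        then have "length p = length p1 + length p2" by simp
        then have "length p2 = 0" using d_le[OF p12(2)] p(2) le by linarith
        then have "p2 = []" by simp
        then show False using p12(3) no_loop[of e] e by (auto simp: awalk_Nil_iff)
      qed
      with p show ?thesis by blast
    qed
    obtain p1 p2 where p1: "awalk r p1 (tail ?D e\<^sub>1)" "w \<notin> set (awalk_verts r p1)"
      and p2: "awalk r p2 (tail ?D e\<^sub>2)" "w \<notin> set (awalk_verts r p2)"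
      using avoid e le by meson
    show ?thesis
    proof (rule in_arcs_eq_if_joined[OF e])
      \<comment> \<open>Back along the first walk to the root, then along the second; neither meets
        \<open>w\<close>.\<close>
      show "awalk (tail ?D e\<^sub>1) (rev (map (flip P) p1) @ p2) (tail ?D e\<^sub>2)"
        using awalk_rev[OF p1(1)] p2(1) by (rule awalk_appendI)
      show "w \<notin> set (awalk_verts (tail ?D e\<^sub>1) (rev (map (flip P) p1) @ p2))"
        using set_awalk_verts_append[OF awalk_rev[OF p1(1)] p2(1)] awalk_rev_verts[OF p1(1)] p1 p2 by simp
    qed
  qed
  have parent: "\<exists>e \<in> in_arcs ?D w. d (tail ?D e) < d w" if "w \<in> ?V" "w \<noteq> r" for w
  proof -
    obtain p where p: "awalk r p w" "length p = d w" using d_walk \<open>w \<in> ?V\<close> by blast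
    have "p \<noteq> []" using p \<open>w \<noteq> r\<close> by (auto simp: awalk_Nil_iff)
    then obtain p0 e where p0: "p = p0 @ [e]" by (cases p rule: rev_cases) auto
    then have e: "e \<in> in_arcs ?D w" "awalk r p0 (tail ?D e)"
      using p(1) by (auto simp: awalk_simps)
    have "d (tail ?D e) < d w" using d_le[OF e(2)] p(2) p0 by simp
    with e(1) show ?thesis by blast
  qed
  have dr: "d r = 0" using d_le[of "[]" r] r by (simp add: awalk_Nil_iff)
  have root: "d r < d (tail ?D e)" if "e \<in> in_arcs ?D r" for e
  proof (rule ccontr)
    assume "\<not> d r < d (tail ?D e)"
    then have "d (tail ?D e) = 0" using dr by simp
    then have "awalk r [] (tail ?D e)" using d_walk[of "tail ?D e"] that by auto
    then show False using that no_loop[of e] by (auto simp: awalk_Nil_iff)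
  qed
  define up where "up w = (if w = r then h else SOME e. e \<in> in_arcs ?D w \<and> d (tail ?D e) < d w)" for w
  have up: "up w \<in> in_arcs ?D w" "d (tail ?D (up w)) < d w" if "w \<in> ?V" "w \<noteq> r" for w
  proof -
    have "\<exists>e. e \<in> in_arcs ?D w \<and> d (tail ?D e) < d w" using parent[OF that] by blast
    from someI_ex[OF this] \<open>w \<noteq> r\<close> show "up w \<in> in_arcs ?D w" "d (tail ?D (up w)) < d w"
      unfolding up_def by (simp_all only: if_False)
  qed
  have up_eq: "e = up w" if "e \<in> in_arcs ?D w" "d (tail ?D e) \<le> d w" for e w
  proof -
    have "w \<in> ?V" "w \<noteq> r" using that root by force+
    then show ?thesis
      using unique[OF that(1) up(1) that(2)] up(2)[of w] by (meson less_imp_le)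
  qed
  have ins: "in_arcs ?D w = (if w = r then {} else {up w}) \<union>
      (\<lambda>c. flip P (up c)) ` {c \<in> ?V - {r}. tail ?D (up c) = w}" if w: "w \<in> ?V" for w
  proof (intro equalityI subsetI)
    fix e assume e: "e \<in> in_arcs ?D w"
    show "e \<in> (if w = r then {} else {up w}) \<union> (\<lambda>c. flip P (up c)) ` {c \<in> ?V - {r}. tail ?D (up c) = w}"
    proof (cases "d (tail ?D e) \<le> d w")
      case True
      then have "e = up w" by (rule up_eq[OF e])
      moreover have "w \<noteq> r" using root[of e] e True by auto
      ultimately show ?thesis by simp
    next
      case False
      \<comment> \<open>The reversed arc ends at \<open>tail ?D e\<close>, which is farther from the
        root than \<open>w\<close>.\<close>
      have "flip P e = up (tail ?D e)"
        by (rule up_eq) (use e False in auto)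
      moreover have "tail ?D e \<noteq> r" using False dr by auto
      moreover have "tail ?D (up (tail ?D e)) = w" using e by (simp flip: \<open>flip P e = up (tail ?D e)\<close>)
      moreover have "e = flip P (up (tail ?D e))" by (simp flip: \<open>flip P e = up (tail ?D e)\<close>)
      ultimately show ?thesis using e by (intro UnI2 image_eqI[of _ _ "tail ?D e"]) auto
    qed
  next
    fix e assume "e \<in> (if w = r then {} else {up w}) \<union> (\<lambda>c. flip P (up c)) ` {c \<in> ?V - {r}. tail ?D (up c) = w}"
    then show "e \<in> in_arcs ?D w" using up w by (force split: if_splits)
  qed
  have rp: "rooted_piece P r h up d"
    unfolding rooted_piece_def
  proof (intro conjI ballI)
    fix w assume "w \<in> ?V - {r}"
    then show "up w \<in> in_arcs ?D w" "d (tail ?D (up w)) < d w" using up[of w] by blast+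
  next
    fix w assume "w \<in> ?V"
    then show "in_arcs ?D w = (if w = r then {} else {up w}) \<union>
        (\<lambda>c. flip P (up c)) ` {c \<in> ?V - {r}. tail ?D (up c) = w}" by (rule ins)
  qed (simp_all add: r h up_def)
  have size: "esize P (up w) = vsize P w" if "w \<in> ?V" for w
  proof (cases "w = r")
    case True
    then show ?thesis using order_iso[OF h(3)] by (simp add: up_def esize_def vsize_def)
  next
    case False
    from order_iso[OF iso[of "up w"]] up[OF that False]
    show ?thesis by (simp add: d_def esize_def vsize_def)
  qed
  have "(\<Sum>c\<in>{c \<in> ?V - {r}. tail ?D (up c) = w}. vsize P w * vsize P c / (esize P (up c))\<^sup>2) = real q"
    if w: "w \<in> ?V" for w
  proof -
    have "(\<Sum>c\<in>{c \<in> ?V - {r}. tail ?D (up c) = w}. vsize P w * vsize P c / (esize P (up c))\<^sup>2) =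
        (\<Sum>c\<in>{c \<in> ?V - {r}. tail ?D (up c) = w}. vsize P w / esize P (up c))"
      using vsize_pos by (intro sum.cong) (auto simp: size power2_eq_square)
    also have "\<dots> = real q"
      using rooted_piece_degree(2)[OF rp w] deg w vsize_pos[OF w] by (simp add: size)
    finally show ?thesis .
  qed
  with rp show ?thesis by blast
qed

text \<open>Opposite to the funnel, the edge group is here the group of the parent. The sum at
  \<open>x i\<close> has one term, \<open>vsize P (x (Suc i)) / vsize P (x i)\<close>, which is the
  degree of the child minus 1; so regularity is used at the child.\<close>

lemma cusp_rooted:
  assumes cusp: "cusp P" and deg: "\<forall>v \<in> verts (ugraph P). degree P v = real q + 1"
  shows "\<exists>r h up ht. rooted_piece P r h up ht \<and> (\<forall>w \<in> verts (ugraph P).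
    (\<Sum>c\<in>{c \<in> verts (ugraph P) - {r}. tail (ugraph P) (up c) = w}.
       vsize P w * vsize P c / (esize P (up c))\<^sup>2) = real q)"
proof -
  let ?D = "ugraph P" and ?V = "verts (ugraph P)"
  have gog: "graph_of_groups_with_boundary P"
    using cusp by (auto simp: cusp_def)
  interpret graph_of_groups_with_boundary P by (rule gog)
  obtain x e h where x: "bij_betw x UNIV ?V" and arcs: "arcs ?D = range e \<union> flip P ` range e"
    and e: "\<And>i. tail ?D (e i) = x i" "\<And>i. head ?D (e i) = x (Suc i)"
    and h: "prongs P = {h}" "head ?D h = x 0"
    and iso: "\<And>i. emono P (flip P (e i)) \<in> iso (egroup P (flip P (e i))) (vgroup P (x i))"
    using cusp unfolding cusp_def by blast
  have x_eq: "x i = x j \<longleftrightarrow> i = j" for i j using x by (auto simp: bij_betw_def inj_eq)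
  have xV: "x i \<in> ?V" for i using x by (auto simp: bij_betw_def)
  have V: "\<exists>i. w = x i" if "w \<in> ?V" for w using x that by (auto simp: bij_betw_def)
  define ht where "ht = inv_into UNIV x"
  have ht: "ht (x i) = i" for i using x by (simp add: ht_def bij_betw_def)
  define up where "up w = (if w = x 0 then h else e (ht w - 1))" for w
  have up: "up (x 0) = h" "up (x (Suc i)) = e i" for i by (auto simp: up_def x_eq ht)
  have earc: "e i \<in> arcs ?D" for i using arcs by auto
  have children: "{c \<in> ?V - {x 0}. tail ?D (up c) = x i} = {x (Suc i)}" for i
  proof (intro equalityI subsetI)
    fix c assume "c \<in> {c \<in> ?V - {x 0}. tail ?D (up c) = x i}"
    then have c: "c \<in> ?V" "c \<noteq> x 0" "tail ?D (up c) = x i" by auto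
    then obtain j where "c = x (Suc j)" using V by (metis not0_implies_Suc)
    then show "c \<in> {x (Suc i)}" using c by (simp add: up e x_eq)
  qed (auto simp: up e x_eq xV)
  have ins: "in_arcs ?D (x i) = (if x i = x 0 then {} else {up (x i)}) \<union> (\<lambda>c. flip P (up c)) ` {x (Suc i)}" for i
  proof (intro equalityI subsetI)
    fix a assume a: "a \<in> in_arcs ?D (x i)"
    then consider j where "a = e j" | j where "a = flip P (e j)" using arcs by auto
    then show "a \<in> (if x i = x 0 then {} else {up (x i)}) \<union> (\<lambda>c. flip P (up c)) ` {x (Suc i)}"
      by cases (use a in \<open>auto simp: e x_eq earc up\<close>)
  next
    fix a assume "a \<in> (if x i = x 0 then {} else {up (x i)}) \<union> (\<lambda>c. flip P (up c)) ` {x (Suc i)}"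
    then show "a \<in> in_arcs ?D (x i)"
      by (cases i) (auto simp: up e earc x_eq)
  qed
  have rp: "rooted_piece P (x 0) h up ht"
    unfolding rooted_piece_def
  proof (intro conjI ballI)
    fix w assume "w \<in> ?V - {x 0}"
    then obtain i where "w = x (Suc i)" using V by (metis DiffE insertI1 not0_implies_Suc)
    then show "up w \<in> in_arcs ?D w" "ht (tail ?D (up w)) < ht w" by (auto simp: up e earc ht)
  next
    fix w assume "w \<in> ?V"
    then obtain i where "w = x i" using V by blast
    then show "in_arcs ?D w = (if w = x 0 then {} else {up w}) \<union>
        (\<lambda>c. flip P (up c)) ` {c \<in> ?V - {x 0}. tail ?D (up c) = w}"
      using ins children by simp
  qed (auto simp: xV h up)
  have size: "esize P (e i) = vsize P (x i)" for i
    using order_iso[OF iso, of i] esize_flip[OF earc, of i] by (simp add: esize_def vsize_def)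
  have "(\<Sum>c\<in>{c \<in> ?V - {x 0}. tail ?D (up c) = w}. vsize P w * vsize P c / (esize P (up c))\<^sup>2) = real q"
    if "w \<in> ?V" for w
  proof -
    obtain i where w: "w = x i" using V \<open>w \<in> ?V\<close> by blast
    have "degree P (x (Suc i)) = vsize P (x (Suc i)) / vsize P (x i) + 1"
      using rooted_piece_degree(2)[OF rp xV, of "Suc i"] vsize_pos[OF xV, of "Suc i"]
      unfolding children by (simp add: up size)
    then have "vsize P (x (Suc i)) / vsize P (x i) = real q" using deg xV by simp
    then show ?thesis using vsize_pos[OF xV, of i]
      unfolding w children by (simp add: up size power2_eq_square)
  qed
  with rp show ?thesis by blast
qed

section \<open>Gluing the ends to the core\<close>

locale geometrically_finite_decomposition =
  fixes q :: nat and G :: "('v, 'e, 'g, 'h) gog" and F :: "'e set" and L :: "'v set"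
    and Fs Cs :: "'v set set"
  assumes decomposition: "geometrically_finite q G F L Fs Cs"
begin

sublocale graph_of_groups_with_boundary G
  using decomposition by (auto simp: geometrically_finite_def graph_of_groups_def)

abbreviation "V \<equiv> verts (ugraph G)"
abbreviation "src \<equiv> tail (ugraph G)"
abbreviation "tgt \<equiv> head (ugraph G)"
abbreviation "ends \<equiv> Fs \<union> Cs"
abbreviation "end_piece W \<equiv> piece (cut G F) W"

lemma no_prongs: "prongs G = {}"
  using decomposition by (auto simp: geometrically_finite_def graph_of_groups_def)

lemma finite_core: "finite L"
  using decomposition by (auto simp: geometrically_finite_def)

lemma flip_cut_arc: "e \<in> F \<Longrightarrow> flip G e \<in> F"
  using decomposition by (auto simp: geometrically_finite_def)

lemma cut_arcs: "F \<subseteq> arcs (ugraph G)"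
  using decomposition by (auto simp: geometrically_finite_def)

lemma flip_cut_arc_iff: "flip G e \<in> F \<longleftrightarrow> e \<in> F"
  using flip_cut_arc[of e] flip_cut_arc[of "flip G e"] by auto

lemma cut_simps [simp]:
  "verts (ugraph (cut G F)) = V" "arcs (ugraph (cut G F)) = arcs (ugraph G) - F"
  "tail (ugraph (cut G F)) = src" "head (ugraph (cut G F)) = tgt"
  by (auto simp: cut_def)

sublocale cut: wf_digraph "ugraph (cut G F)"
  by unfold_locales auto

lemma sccs: "pre_digraph.sccs_verts (ugraph (cut G F)) = insert L ends"
  using decomposition by (auto simp: geometrically_finite_def)

lemma component_reachable:
  "S \<in> insert L ends \<Longrightarrow> u \<in> S \<Longrightarrow> v \<in> S \<Longrightarrow> u \<rightarrow>\<^sup>*\<^bsub>ugraph (cut G F)\<^esub> v"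
  unfolding sccs[symmetric] cut.in_sccs_verts_conv_reachable by blast

lemma component_subset: "S \<in> insert L ends \<Longrightarrow> S \<subseteq> V"
  using component_reachable[of S] cut.reachable_in_verts(1) by (metis cut_simps(1) subsetI)

lemma component_nonempty: "S \<in> insert L ends \<Longrightarrow> S \<noteq> {}"
  unfolding sccs[symmetric] cut.in_sccs_verts_conv_reachable by blast

lemma components_cover: "v \<in> V \<Longrightarrow> \<exists>S \<in> insert L ends. v \<in> S"
  using sccs cut.scc_of_in_sccs_verts[of v] cut.in_scc_of_self[of v] by auto

lemma components_disjoint:
  "S \<in> insert L ends \<Longrightarrow> T \<in> insert L ends \<Longrightarrow> v \<in> S \<Longrightarrow> v \<in> T \<Longrightarrow> S = T"
  using cut.sccs_verts_disjoint[of S T] sccs by blast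

lemma core_not_end: "W \<in> ends \<Longrightarrow> v \<in> W \<Longrightarrow> v \<notin> L"
  using components_disjoint[of W L v] decomposition by (auto simp: geometrically_finite_def)

text \<open>As \<open>F\<close> is closed under \<open>flip\<close>, both orientations survive the
  cutting, and the endpoints reach each other.\<close>

lemma uncut_arc_component:
  assumes e: "e \<in> arcs (ugraph G) - F" and S: "S \<in> insert L ends"
  shows "src e \<in> S \<longleftrightarrow> tgt e \<in> S"
proof -
  have walk: "src e' \<rightarrow>\<^sup>*\<^bsub>ugraph (cut G F)\<^esub> tgt e'" if "e' \<in> arcs (ugraph G) - F" for e'
    using that cut.arc_implies_awalk[of e'] cut.reachable_awalkI by auto
  have "tgt e \<rightarrow>\<^sup>*\<^bsub>ugraph (cut G F)\<^esub> src e"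
    using walk[of "flip G e"] e by (auto simp: flip_cut_arc_iff)
  with walk[OF e] S show ?thesis
    unfolding sccs[symmetric] cut.in_sccs_verts_conv_reachable by blast
qed

lemma end_piece_simps [simp]:
  "verts (ugraph (end_piece W)) = W" "tail (ugraph (end_piece W)) = src"
  "head (ugraph (end_piece W)) = tgt" "prongs (end_piece W) = {h \<in> F. tgt h \<in> W}"
  by (auto simp: piece_def cut_def no_prongs induce_subgraph_def)

lemma end_piece_sizes [simp]: "vsize (end_piece W) = vsize G" "esize (end_piece W) = esize G"
  by (auto simp: piece_def cut_def vsize_def esize_def fun_eq_iff)

text \<open>No uncut arc enters or leaves \<open>W\<close>, so inducing on \<open>W\<close> loses
  nothing.\<close>

lemma end_piece_in_arcs:
  assumes "W \<in> ends" "w \<in> W"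
  shows "in_arcs (ugraph (end_piece W)) w = in_arcs (ugraph G) w - F"
proof -
  have "arcs (ugraph (end_piece W)) = {e \<in> arcs (ugraph G) - F. src e \<in> W \<and> tgt e \<in> W}"
    by (auto simp: piece_def induce_subgraph_def)
  then show ?thesis using uncut_arc_component[of _ W] assms by auto
qed

lemma end_piece_flip:
  assumes "e \<in> arcs (ugraph (end_piece W))"
  shows "flip (end_piece W) e = flip G e"
  using assms by (auto simp: piece_def cut_def induce_subgraph_def)

lemma end_piece_rooted:
  assumes W: "W \<in> ends"
  shows "\<exists>r h up ht. rooted_piece (end_piece W) r h up ht \<and> (\<forall>w \<in> W.
    (\<Sum>c\<in>{c \<in> W - {r}. src (up c) = w}. vsize G w * vsize G c / (esize G (up c))\<^sup>2) = real q)"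
proof -
  have "orbifold_funnel (end_piece W) \<or> cusp (end_piece W)"
    and "\<forall>v \<in> verts (ugraph (end_piece W)). degree (end_piece W) v = real q + 1"
    using decomposition W by (auto simp: geometrically_finite_def)
  then show ?thesis
    using funnel_rooted[of "end_piece W" q] cusp_rooted[of "end_piece W" q] by auto
qed

text \<open>If the cut arc into an end came from an end, these two ends would be closed under arcs.\<close>

lemma end_attached_to_core:
  assumes W: "W \<in> ends" and h: "h \<in> F" "tgt h \<in> W"
  shows "src h \<in> L"
proof (rule ccontr)
  assume "src h \<notin> L"
  moreover have harc: "h \<in> arcs (ugraph G)" using h cut_arcs by auto
  ultimately obtain W' where W': "W' \<in> ends" "src h \<in> W'"
    using components_cover[of "src h"] by auto
  \<comment> \<open>Each end has a single prong, hence a single cut arc pointing into it.\<close>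
  have unique: "h\<^sub>1 = h\<^sub>2" if X: "X \<in> ends" and "h\<^sub>1 \<in> F" "tgt h\<^sub>1 \<in> X" "h\<^sub>2 \<in> F" "tgt h\<^sub>2 \<in> X" for X h\<^sub>1 h\<^sub>2
  proof -
    obtain k where "prongs (end_piece X) = {k}"
      using end_piece_rooted[OF X] by (auto simp: rooted_piece_def)
    then have "{h \<in> F. tgt h \<in> X} = {k}" by simp
    moreover have "h\<^sub>1 \<in> {h \<in> F. tgt h \<in> X}" "h\<^sub>2 \<in> {h \<in> F. tgt h \<in> X}" using that by auto
    ultimately show ?thesis by simp
  qed
  \<comment> \<open>The cut arcs into the two ends are \<open>h\<close> and its reverse, so all arcs
    entering the union start in it.\<close>
  have closed: "src e \<in> W \<union> W'" if e: "e \<in> arcs (ugraph G)" "tgt e \<in> W \<union> W'" for e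
  proof (cases "e \<in> F")
    case True
    have "e = h \<or> e = flip G h"
      using unique[OF W True _ h] unique[OF W'(1) True _ flip_cut_arc[OF h(1)]] e(2) W'(2) harc by auto
    then show ?thesis using h W' harc by auto
  next
    case False
    then show ?thesis using e uncut_arc_component[of e] W W'(1) by auto
  qed
  have back_closed: "u \<in> W \<union> W'" if "awalk u p v" "v \<in> W \<union> W'" for u p v
    using that by (induction p arbitrary: u) (auto simp: awalk_simps dest!: closed)
  \<comment> \<open>Connectedness gives a walk from the core to \<open>tgt h\<close>; traced
    backwards it would never leave the two ends.\<close>
  obtain l where l: "l \<in> L" using component_nonempty[of L] by auto
  have "l \<in> V" "tgt h \<in> V" using l component_subset[of L] harc by auto
  then obtain p where "awalk l p (tgt h)"
    using connected by (auto simp: strongly_connected_def reachable_awalk)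
  from back_closed[OF this] h(2) have "l \<in> W \<union> W'" by blast
  then show False using l core_not_end[OF W] core_not_end[OF W'(1)] by blast
qed

text \<open>Glues the rooted structures of the ends into functions on \<open>V - L\<close>. The
  prong at the root of an end is again a cut arc of \<open>G\<close>, so there \<open>up\<close>
  comes from the core.\<close>

lemma end_structure:
  "\<exists>up ht. (\<forall>w \<in> V - L. up w \<in> in_arcs (ugraph G) w \<and> ht (src (up w)) < (ht w :: nat)) \<and>
     (\<forall>w \<in> V - L. in_arcs (ugraph G) w =
        insert (up w) ((\<lambda>c. flip G (up c)) ` {c \<in> V - L. src (up c) = w})) \<and>
     (\<forall>w \<in> L. in_arcs (ugraph G) w = {e \<in> in_arcs (ugraph G) w. src e \<in> L} \<union>
        (\<lambda>c. flip G (up c)) ` {c \<in> V - L. src (up c) = w}) \<and>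
     (\<forall>w \<in> V - L. (\<Sum>c\<in>{c \<in> V - L. src (up c) = w}.
        vsize G w * vsize G c / (esize G (up c))\<^sup>2) = real q)"
proof -
  define Q where "Q W r h u t \<longleftrightarrow> rooted_piece (end_piece W) r h u t \<and> (\<forall>w \<in> W.
      (\<Sum>c\<in>{c \<in> W - {r}. src (u c) = w}. vsize G w * vsize G c / (esize G (u c))\<^sup>2) = real q)"
    for W r h u t
  have "\<forall>W \<in> ends. \<exists>x. Q W (fst x) (fst (snd x)) (fst (snd (snd x))) (snd (snd (snd x)))"
  proof
    fix W assume "W \<in> ends"
    then obtain r h u t where "Q W r h u t" using end_piece_rooted unfolding Q_def by blast
    then show "\<exists>x. Q W (fst x) (fst (snd x)) (fst (snd (snd x))) (snd (snd (snd x)))"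
      by (intro exI[of _ "(r, h, u, t)"]) simp
  qed
  from bchoice[OF this] obtain x where x:
    "\<forall>W \<in> ends. Q W (fst (x W)) (fst (snd (x W))) (fst (snd (snd (x W)))) (snd (snd (snd (x W))))" ..
  define r h u t where "r W = fst (x W)" "h W = fst (snd (x W))" "u W = fst (snd (snd (x W)))"
    "t W = snd (snd (snd (x W)))" for W
  have rooted: "\<And>W. W \<in> ends \<Longrightarrow> rooted_piece (end_piece W) (r W) (h W) (u W) (t W)"
    and sum: "\<And>W w. W \<in> ends \<Longrightarrow> w \<in> W \<Longrightarrow>
      (\<Sum>c\<in>{c \<in> W - {r W}. src (u W c) = w}. vsize G w * vsize G c / (esize G (u W c))\<^sup>2) = real q"
    using x unfolding Q_def r_h_u_t_def by blast+
  have "\<forall>w \<in> V - L. \<exists>W. W \<in> ends \<and> w \<in> W" using components_cover by blast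
  from bchoice[OF this] obtain E where E: "\<And>w. w \<in> V - L \<Longrightarrow> E w \<in> ends \<and> w \<in> E w" by blast
  have E_eq: "E w = W" if "W \<in> ends" "w \<in> W" for w W
    using E[of w] that components_disjoint[of W "E w" w] component_subset[of W] core_not_end[OF that] by auto
  have endV: "w \<in> V - L" if "W \<in> ends" "w \<in> W" for w W
    using that component_subset[of W] core_not_end[OF that] by auto
  define up where "up w = u (E w) w" for w
  \<comment> \<open>The core gets height 0 and the ends are raised by 1, so that the parent of a
    root is lower too.\<close>
  define ht where "ht w = (if w \<in> L then 0 else Suc (t (E w) w))" for w
  have prongs: "{h \<in> F. tgt h \<in> W} = {h W}" "tgt (h W) = r W" "u W (r W) = h W" "r W \<in> W" if "W \<in> ends" for W
    using rooted[OF that] by (auto simp: rooted_piece_def)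
  have root: "up (r W) = h W" "h W \<in> F" "src (h W) \<in> L" "h W \<in> arcs (ugraph G)" if W: "W \<in> ends" for W
  proof -
    show hF: "h W \<in> F" using prongs(1)[OF W] by auto
    show "up (r W) = h W" using prongs[OF W] E_eq[OF W] by (simp add: up_def)
    show "src (h W) \<in> L" using end_attached_to_core[OF W hF] prongs[OF W] by simp
    show "h W \<in> arcs (ugraph G)" using hF cut_arcs by auto
  qed
  have inner: "u W w \<in> in_arcs (ugraph G) w" "u W w \<notin> F" "src (u W w) \<in> W" "t W (src (u W w)) < t W w"
      "flip (end_piece W) (u W w) = flip G (u W w)"
    if W: "W \<in> ends" and w: "w \<in> W" "w \<noteq> r W" for W w
  proof -
    have *: "u W w \<in> in_arcs (ugraph (end_piece W)) w" "t W (src (u W w)) < t W w"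
      using rooted[OF W] w by (auto simp: rooted_piece_def)
    then show **: "u W w \<in> in_arcs (ugraph G) w" "u W w \<notin> F" "t W (src (u W w)) < t W w"
      using end_piece_in_arcs[OF W w(1)] by auto
    show "src (u W w) \<in> W"
      using ** uncut_arc_component[of "u W w" W] W w by auto
    show "flip (end_piece W) (u W w) = flip G (u W w)" using * by (intro end_piece_flip) auto
  qed
  have children: "{c \<in> V - L. src (up c) = w} = {c \<in> W - {r W}. src (u W c) = w}"
    if W: "W \<in> ends" and w: "w \<in> W" for W w
  proof (intro equalityI subsetI)
    fix c assume "c \<in> {c \<in> V - L. src (up c) = w}"
    then have c: "c \<in> V - L" "src (up c) = w" by auto
    obtain W' where W': "W' \<in> ends" "c \<in> W'" "E c = W'" using E[OF c(1)] by blast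
    \<comment> \<open>The parent of a root lies in the core, so a root is not a child of an end
      vertex.\<close>
    have "c \<noteq> r W'"
    proof
      assume "c = r W'"
      then have "src (up c) \<in> L" using root(1,3)[OF W'(1)] by simp
      then show False using c core_not_end[OF W w] by simp
    qed
    then have "w \<in> W'" using inner(3)[OF W'(1,2)] W'(3) c(2) by (simp add: up_def)
    then have "W' = W" using components_disjoint[of W W' w] W w W' by auto
    then show "c \<in> {c \<in> W - {r W}. src (u W c) = w}"
      using W' c \<open>c \<noteq> r W'\<close> by (auto simp: up_def)
  next
    fix c assume "c \<in> {c \<in> W - {r W}. src (u W c) = w}"
    then show "c \<in> {c \<in> V - L. src (up c) = w}"
      using endV[OF W] E_eq[OF W] by (auto simp: up_def)
  qed
  have up_in: "up w \<in> in_arcs (ugraph G) w \<and> ht (src (up w)) < ht w" if w: "w \<in> V - L" for w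
  proof -
    obtain W where W: "W \<in> ends" "w \<in> W" and EW: "E w = W" using E[OF w] by blast
    show ?thesis
    proof (cases "w = r W")
      case True
      then have "up w = h W" using root(1)[OF W(1)] by simp
      then show ?thesis using root[OF W(1)] prongs(2)[OF W(1)] True w by (simp add: ht_def)
    next
      case False
      note inn = inner[OF W False]
      have "E (src (u W w)) = W" using E_eq[OF W(1) inn(3)] .
      then show ?thesis using inn core_not_end[OF W(1)] w EW by (simp add: ht_def up_def)
    qed
  qed
  have ins: "in_arcs (ugraph G) w = insert (up w) ((\<lambda>c. flip G (up c)) ` {c \<in> V - L. src (up c) = w})"
    if w: "w \<in> V - L" for w
  proof -
    define W where "W = E w"
    have W: "W \<in> ends" "w \<in> W" using E[OF w] by (auto simp: W_def)
    have img: "(\<lambda>c. flip (end_piece W) (u W c)) ` {c \<in> W - {r W}. src (u W c) = w} =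
        (\<lambda>c. flip G (up c)) ` {c \<in> V - L. src (up c) = w}"
      unfolding children[OF W]
      by (intro image_cong refl) (use inner(5)[OF W(1)] E_eq[OF W(1)] in \<open>auto simp: up_def\<close>)
    have "in_arcs (ugraph G) w = (in_arcs (ugraph G) w - F) \<union> {h \<in> F. tgt h = w}"
      using cut_arcs by auto
    \<comment> \<open>An arc into \<open>w\<close> is cut only if \<open>w\<close> is a root, and
      then it is \<open>up w\<close>.\<close>
    also have "in_arcs (ugraph G) w - F = (if w = r W then {} else {up w}) \<union>
        (\<lambda>c. flip G (up c)) ` {c \<in> V - L. src (up c) = w}"
      using rooted[OF W(1)] W(2) unfolding end_piece_in_arcs[OF W, symmetric] img[symmetric]
      by (simp add: rooted_piece_def up_def W_def)
    also have "{h \<in> F. tgt h = w} = (if w = r W then {up w} else {})"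
    proof -
      have "{h \<in> F. tgt h = w} = {k \<in> {h \<in> F. tgt h \<in> W}. tgt k = w}" using W(2) by auto
      also have "\<dots> = {k \<in> {h W}. tgt k = w}" unfolding prongs(1)[OF W(1)] ..
      also have "\<dots> = (if w = r W then {up w} else {})"
        using prongs(2)[OF W(1)] root(1)[OF W(1)] by auto
      finally show ?thesis .
    qed
    finally show ?thesis by (cases "w = r W") simp_all
  qed
  have core: "in_arcs (ugraph G) w = {e \<in> in_arcs (ugraph G) w. src e \<in> L} \<union>
      (\<lambda>c. flip G (up c)) ` {c \<in> V - L. src (up c) = w}" if w: "w \<in> L" for w
  proof (intro equalityI subsetI)
    fix e assume e: "e \<in> in_arcs (ugraph G) w"
    show "e \<in> {e \<in> in_arcs (ugraph G) w. src e \<in> L} \<union> (\<lambda>c. flip G (up c)) ` {c \<in> V - L. src (up c) = w}"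
    proof (cases "src e \<in> L")
      case False
      then have s: "src e \<in> V - L" using e by auto
      obtain W where W: "W \<in> ends" "src e \<in> W" using E[OF s] by blast
      have "e \<in> F" using uncut_arc_component[of e L] e w False by auto
      then have "flip G e \<in> {h \<in> F. tgt h \<in> W}" using e W flip_cut_arc by auto
      then have "flip G e = h W" unfolding prongs(1)[OF W(1)] by simp
      have "src e = tgt (flip G e)" using e by simp
      also have "\<dots> = r W"
        unfolding \<open>flip G e = h W\<close> by (rule prongs(2)[OF W(1)])
      finally have *: "src e = r W" .
      have "up (src e) = flip G e"
        unfolding * \<open>flip G e = h W\<close> by (rule root(1)[OF W(1)])
      then show ?thesis using s e by (intro UnI2 image_eqI[of _ _ "src e"]) auto
    qed (use e in auto)
  next
    fix e assume "e \<in> {e \<in> in_arcs (ugraph G) w. src e \<in> L} \<union> (\<lambda>c. flip G (up c)) ` {c \<in> V - L. src (up c) = w}"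
    then show "e \<in> in_arcs (ugraph G) w" using up_in by auto
  qed
  have sums: "(\<Sum>c\<in>{c \<in> V - L. src (up c) = w}. vsize G w * vsize G c / (esize G (up c))\<^sup>2) = real q"
    if w: "w \<in> V - L" for w
  proof -
    define W where "W = E w"
    have W: "W \<in> ends" "w \<in> W" using E[OF w] by (auto simp: W_def)
    have "(\<Sum>c\<in>{c \<in> V - L. src (up c) = w}. vsize G w * vsize G c / (esize G (up c))\<^sup>2) =
        (\<Sum>c\<in>{c \<in> W - {r W}. src (u W c) = w}. vsize G w * vsize G c / (esize G (u W c))\<^sup>2)"
      unfolding children[OF W] by (intro sum.cong refl) (use E_eq[OF W(1)] in \<open>auto simp: up_def\<close>)
    then show ?thesis using sum[OF W] by simp
  qed
  show ?thesis
    by (intro exI[of _ up] exI[of _ ht] conjI ballI)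
      (rule conjunct1[OF up_in] conjunct2[OF up_in] ins core sums, assumption)+
qed

end

section \<open>Outgoing solutions\<close>

text \<open>Funnels and cusps are no longer distinguished: \<open>sizes_end\<close> is what is kept
  of the regularity of the ends.\<close>

locale rooted_ends = graph_of_groups_with_boundary G
  for G :: "('v, 'e, 'g, 'h) gog" +
  fixes q :: nat and L :: "'v set" and up :: "'v \<Rightarrow> 'e" and ht :: "'v \<Rightarrow> nat"
  assumes q: "q \<ge> 2" and finite_L: "finite L" and L_subset: "L \<subseteq> verts (ugraph G)"
    and up_in_arcs: "w \<in> verts (ugraph G) - L \<Longrightarrow> up w \<in> in_arcs (ugraph G) w"
    and ht_up: "w \<in> verts (ugraph G) - L \<Longrightarrow> ht (tail (ugraph G) (up w)) < ht w"
    and in_arcs_end: "w \<in> verts (ugraph G) - L \<Longrightarrow> in_arcs (ugraph G) w =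
        insert (up w) ((\<lambda>c. flip G (up c)) ` {c \<in> verts (ugraph G) - L. tail (ugraph G) (up c) = w})"
    and in_arcs_core: "w \<in> L \<Longrightarrow> in_arcs (ugraph G) w =
        {e \<in> in_arcs (ugraph G) w. tail (ugraph G) e \<in> L} \<union>
        (\<lambda>c. flip G (up c)) ` {c \<in> verts (ugraph G) - L. tail (ugraph G) (up c) = w}"
    and sizes_end: "w \<in> verts (ugraph G) - L \<Longrightarrow>
        (\<Sum>c\<in>{c \<in> verts (ugraph G) - L. tail (ugraph G) (up c) = w}.
        vsize G w * vsize G c / (esize G (up c))\<^sup>2) = real q"
begin

abbreviation "V \<equiv> verts (ugraph G)"

definition par :: "'v \<Rightarrow> 'v" where "par w = tail (ugraph G) (up w)"

definition ch :: "'v \<Rightarrow> 'v set" where "ch w = {c \<in> V - L. par c = w}"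

text \<open>The coefficient of the parent in the adjacency operator at \<open>w\<close>;
  \<open>down_weight c\<close> is that of \<open>c\<close> at the parent of \<open>c\<close>. Both
  are indexed by the child.\<close>

definition up_weight :: "'v \<Rightarrow> real" where "up_weight w = vsize G w / esize G (up w)"

definition down_weight :: "'v \<Rightarrow> real" where "down_weight c = vsize G (par c) / esize G (up c)"

lemma par_in_verts: "w \<in> V - L \<Longrightarrow> par w \<in> V"
  using up_in_arcs[of w] by (auto simp: par_def)

lemma ht_par: "w \<in> V - L \<Longrightarrow> ht (par w) < ht w"
  using ht_up by (simp add: par_def)

lemma chD: "c \<in> ch w \<Longrightarrow> c \<in> V - L \<and> par c = w \<and> ht w < ht c"
  using ht_par by (auto simp: ch_def)

text \<open>Symmetry of the adjacency operator for the weights \<open>1 / vsize\<close>.\<close>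

lemma down_weight_conv_up_weight: "c \<in> ch w \<Longrightarrow> down_weight c = vsize G w * up_weight c / vsize G c"
  using vsize_pos[of c] by (auto simp: down_weight_def up_weight_def ch_def)

lemma inj_flip_up: "inj_on (\<lambda>c. flip G (up c)) (ch w)"
proof (rule inj_onI)
  fix c c' assume "c \<in> ch w" "c' \<in> ch w" "flip G (up c) = flip G (up c')"
  then show "c = c'" using up_in_arcs[of c] up_in_arcs[of c'] by (auto simp: ch_def arev_eq_iff)
qed

lemma finite_ch: "w \<in> V \<Longrightarrow> finite (ch w)"
proof (rule finite_imageD[OF finite_subset inj_flip_up])
  assume "w \<in> V"
  then show "(\<lambda>c. flip G (up c)) ` ch w \<subseteq> in_arcs (ugraph G) w" "finite (in_arcs (ugraph G) w)"
    using in_arcs_end[of w] in_arcs_core[of w] locally_finite[of w] by (auto simp: ch_def par_def)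
qed

lemma sum_flip_up:
  "(\<Sum>e\<in>(\<lambda>c. flip G (up c)) ` ch w. complex_of_real (vsize G w / esize G e) * u (tail (ugraph G) e)) =
    (\<Sum>c\<in>ch w. of_real (down_weight c) * u c)"
  unfolding sum.reindex[OF inj_flip_up]
  by (intro sum.cong refl) (use up_in_arcs in \<open>auto simp: down_weight_def ch_def esize_flip\<close>)

lemma sum_down_weight_up_weight:
  assumes "w \<in> V - L"
  shows "(\<Sum>c\<in>ch w. down_weight c * up_weight c) = real q"
  unfolding sizes_end[OF assms, symmetric]
  by (intro sum.cong) (auto simp: ch_def par_def down_weight_def up_weight_def power2_eq_square)

lemma adjacency_end:
  assumes w: "w \<in> V - L"
  shows "adjacency G u w = of_real (up_weight w) * u (par w) + (\<Sum>c\<in>ch w. of_real (down_weight c) * u c)"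
proof -
  have "up w \<notin> (\<lambda>c. flip G (up c)) ` ch w"
  proof
    assume "up w \<in> (\<lambda>c. flip G (up c)) ` ch w"
    then obtain c where c: "c \<in> ch w" "up w = flip G (up c)" by auto
    then have "par w = c" using up_in_arcs[of c] by (auto simp: par_def ch_def)
    then show False using ht_par[OF w] chD[OF c(1)] by simp
  qed
  moreover have "in_arcs (ugraph G) w = insert (up w) ((\<lambda>c. flip G (up c)) ` ch w)"
    using in_arcs_end[OF w] by (simp add: ch_def par_def)
  moreover have "adjacency G u w =
      (\<Sum>e\<in>in_arcs (ugraph G) w. of_real (vsize G w / esize G e) * u (tail (ugraph G) e))"
    using w by (simp add: adjacency_def)
  ultimately have "adjacency G u w = of_real (vsize G w / esize G (up w)) * u (tail (ugraph G) (up w)) +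
      (\<Sum>e\<in>(\<lambda>c. flip G (up c)) ` ch w. of_real (vsize G w / esize G e) * u (tail (ugraph G) e))"
    using w finite_ch[of w] by simp
  then show ?thesis unfolding sum_flip_up by (simp only: up_weight_def par_def)
qed

text \<open>Summing over arcs counts parallel edges and both orientations of a loop.\<close>

definition core_weight :: "'v \<Rightarrow> 'v \<Rightarrow> complex" where
  "core_weight v w = (\<Sum>e\<in>{e \<in> in_arcs (ugraph G) v. tail (ugraph G) e = w}. of_real (vsize G v / esize G e))"

lemma adjacency_core:
  assumes v: "v \<in> L"
  shows "adjacency G u v = (\<Sum>w\<in>L. core_weight v w * u w) + (\<Sum>c\<in>ch v. of_real (down_weight c) * u c)"
proof -
  let ?A = "{e \<in> in_arcs (ugraph G) v. tail (ugraph G) e \<in> L}" and ?B = "(\<lambda>c. flip G (up c)) ` ch v"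
  have vV: "v \<in> V" using v L_subset by auto
  have disj: "?A \<inter> ?B = {}" using up_in_arcs by (auto simp: ch_def)
  have ins: "in_arcs (ugraph G) v = ?A \<union> ?B"
    unfolding ch_def par_def by (rule in_arcs_core[OF v])
  have fin: "finite ?A" by (rule finite_subset[OF _ locally_finite[OF vV]]) auto
  have "(\<Sum>e\<in>?A. of_real (vsize G v / esize G e) * u (tail (ugraph G) e)) =
      (\<Sum>w\<in>L. \<Sum>e\<in>{e \<in> ?A. tail (ugraph G) e = w}. of_real (vsize G v / esize G e) * u (tail (ugraph G) e))"
    by (rule sum.group[symmetric]) (use fin finite_L in auto)
  also have "\<dots> = (\<Sum>w\<in>L. core_weight v w * u w)"
    unfolding core_weight_def sum_distrib_right by (intro sum.cong) auto
  finally have "(\<Sum>e\<in>?A. of_real (vsize G v / esize G e) * u (tail (ugraph G) e)) = (\<Sum>w\<in>L. core_weight v w * u w)" .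
  moreover have "adjacency G u v = (\<Sum>e\<in>?A \<union> ?B. of_real (vsize G v / esize G e) * u (tail (ugraph G) e))"
    unfolding ins[symmetric] using vV by (simp add: adjacency_def)
  ultimately show ?thesis
    using sum.union_disjoint[OF fin _ disj, of "\<lambda>e. complex_of_real (vsize G v / esize G e) * u (tail (ugraph G) e)"]
      finite_ch[OF vV] sum_flip_up[of v u] by simp
qed

text \<open>
  An outgoing solution on an end is one that is multiplied by \<open>up_weight w / (sqrt q * \<mu>)\<close> in the
  step from the parent of \<open>w\<close> to \<open>w\<close>.
\<close>

definition defect :: "complex \<Rightarrow> ('v \<Rightarrow> complex) \<Rightarrow> 'v \<Rightarrow> complex" where
  "defect \<mu> u w = u w - of_real (up_weight w) / (of_real (sqrt (real q)) * \<mu>) * u (par w)"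

section \<open>Recursion and energy of the defect\<close>

lemma shifted_adjacency_eqD:
  assumes eq: "shifted_adjacency G q \<mu> u = f"
  shows "adjacency G u w = of_real (sqrt (real q)) * (\<mu> + inverse \<mu>) * u w + 2 * of_real (sqrt (real q)) * f w"
proof -
  have s: "complex_of_real (sqrt (real q)) \<noteq> 0" using q by simp
  have "f w = 1 / (2 * of_real (sqrt (real q))) * adjacency G u w - zmu \<mu> * u w"
    using fun_cong[OF eq, of w] by (simp add: shifted_adjacency_def cscale_def)
  with s show ?thesis by (simp add: zmu_def field_simps)
qed

text \<open>By \<open>sum_down_weight_up_weight\<close> the multiples of \<open>u w\<close>
  subtracted in the defects of the children add up to \<open>sqrt q / \<mu> * u w\<close>. This
  cancels the \<open>inverse \<mu>\<close> half of the spectral parameter, and the rest is a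
  multiple of the defect at \<open>w\<close>.\<close>

lemma defect_eq:
  assumes eq: "shifted_adjacency G q \<mu> u = f" and \<mu>: "\<mu> \<noteq> 0" and w: "w \<in> V - L"
  shows "of_real (sqrt (real q)) * \<mu> * defect \<mu> u w =
    (\<Sum>c\<in>ch w. of_real (down_weight c) * defect \<mu> u c) - 2 * of_real (sqrt (real q)) * f w"
proof -
  define s where "s = complex_of_real (sqrt (real q))"
  have s: "s \<noteq> 0" "s * s = of_nat q"
    using q by (simp_all add: s_def flip: of_real_mult)
  have "(\<Sum>c\<in>ch w. of_real (down_weight c) * defect \<mu> u c) =
      (\<Sum>c\<in>ch w. of_real (down_weight c) * u c) - (\<Sum>c\<in>ch w. of_real (down_weight c * up_weight c)) / (s * \<mu>) * u w"
    unfolding sum_distrib_right sum_divide_distrib sum_subtractf[symmetric]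
    by (intro sum.cong) (auto simp: defect_def s_def ch_def algebra_simps)
  also have "(\<Sum>c\<in>ch w. complex_of_real (down_weight c * up_weight c)) = s * s"
    using arg_cong[OF sum_down_weight_up_weight[OF w], of complex_of_real] by (simp add: s)
  also have "(\<Sum>c\<in>ch w. of_real (down_weight c) * u c) =
      s * (\<mu> + inverse \<mu>) * u w + 2 * s * f w - of_real (up_weight w) * u (par w)"
    using adjacency_end[OF w, of u] shifted_adjacency_eqD[OF eq, of w] by (simp add: s_def)
  finally show ?thesis using s(1) \<mu>
    by (simp add: defect_def flip: s_def) (simp add: field_simps)
qed

lemma sum_up_weight_square: "w \<in> V - L \<Longrightarrow> (\<Sum>c\<in>ch w. (up_weight c)\<^sup>2 / vsize G c) = real q / vsize G w"
proof -
  assume w: "w \<in> V - L"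
  have "real q = vsize G w * (\<Sum>c\<in>ch w. (up_weight c)\<^sup>2 / vsize G c)"
    unfolding sum_down_weight_up_weight[OF w, symmetric] sum_distrib_left by (intro sum.cong) (auto simp: down_weight_conv_up_weight power2_eq_square)
  then show ?thesis using vsize_pos[of w] w by simp
qed

text \<open>Cauchy-Schwarz with weights \<open>sqrt (vsize G c)\<close>: by symmetry the first
  factor is \<open>vsize G w * q\<close>, and this q cancels the square of \<open>sqrt q\<close> on
  the left.\<close>

lemma defect_energy:
  assumes eq: "shifted_adjacency G q \<mu> u = f" and \<mu>: "\<mu> \<noteq> 0" and w: "w \<in> V - L" and f: "f w = 0"
  shows "(cmod \<mu>)\<^sup>2 * ((cmod (defect \<mu> u w))\<^sup>2 / vsize G w) \<le> (\<Sum>c\<in>ch w. (cmod (defect \<mu> u c))\<^sup>2 / vsize G c)"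
proof -
  let ?S = "vsize G" and ?D = "\<lambda>c. cmod (defect \<mu> u c)"
  have Sw: "?S w > 0" using w vsize_pos by auto
  have Sc: "?S c > 0" if "c \<in> ch w" for c using that vsize_pos by (auto simp: ch_def)
  have down_weight: "down_weight c \<ge> 0" if "c \<in> ch w" for c
    by (simp add: down_weight_def vsize_def esize_def)
  have "sqrt (real q) * cmod \<mu> * ?D w = cmod (\<Sum>c\<in>ch w. of_real (down_weight c) * defect \<mu> u c)"
    using arg_cong[OF defect_eq[OF eq \<mu> w], of cmod] f by (simp add: norm_mult)
  also have "\<dots> \<le> (\<Sum>c\<in>ch w. cmod (of_real (down_weight c) * defect \<mu> u c))"
    by (rule norm_sum)
  also have "\<dots> = (\<Sum>c\<in>ch w. (down_weight c * sqrt (?S c)) * (?D c / sqrt (?S c)))"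
    using down_weight Sc by (intro sum.cong) (force simp: norm_mult)+
  finally have "(sqrt (real q) * cmod \<mu> * ?D w)\<^sup>2 \<le> (\<Sum>c\<in>ch w. (down_weight c * sqrt (?S c)) * (?D c / sqrt (?S c)))\<^sup>2"
    by (rule power_mono) auto
  also have "\<dots> \<le> (\<Sum>c\<in>ch w. (down_weight c * sqrt (?S c))\<^sup>2) * (\<Sum>c\<in>ch w. (?D c / sqrt (?S c))\<^sup>2)"
    by (rule Cauchy_Schwarz_ineq_sum)
  also have "(\<Sum>c\<in>ch w. (down_weight c * sqrt (?S c))\<^sup>2) = (\<Sum>c\<in>ch w. ?S w * (down_weight c * up_weight c))"
  proof (intro sum.cong refl)
    fix c assume c: "c \<in> ch w"
    have "(down_weight c * sqrt (?S c))\<^sup>2 = down_weight c * (down_weight c * (sqrt (?S c))\<^sup>2)"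
      by (simp add: power2_eq_square)
    also have "down_weight c * (sqrt (?S c))\<^sup>2 = ?S w * up_weight c"
      using Sc[OF c] by (simp add: down_weight_conv_up_weight[OF c])
    finally show "(down_weight c * sqrt (?S c))\<^sup>2 = ?S w * (down_weight c * up_weight c)" by simp
  qed
  also have "\<dots> = ?S w * real q" by (simp add: sum_down_weight_up_weight[OF w] flip: sum_distrib_left)
  also have "(\<Sum>c\<in>ch w. (?D c / sqrt (?S c))\<^sup>2) = (\<Sum>c\<in>ch w. (?D c)\<^sup>2 / ?S c)"
    using Sc by (intro sum.cong) (force simp: power_divide)+
  finally have "real q * ((cmod \<mu>)\<^sup>2 * (?D w)\<^sup>2) \<le> real q * (?S w * (\<Sum>c\<in>ch w. (?D c)\<^sup>2 / ?S c))"
    by (simp add: power_mult_distrib mult_ac)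
  then have "(cmod \<mu>)\<^sup>2 * (?D w)\<^sup>2 \<le> ?S w * (\<Sum>c\<in>ch w. (?D c)\<^sup>2 / ?S c)"
    using q by simp
  then show ?thesis using Sw by (simp add: field_simps)
qed

text \<open>What needs care is the pullback of \<open>u\<close> along \<open>par\<close>. Grouped by
  parents it costs a factor q by \<open>sum_up_weight_square\<close>; that holds for parents outside
  the core, and the core has finitely many children.\<close>

lemma defect_summable:
  assumes u: "u \<in> ell2 G"
  shows "(\<lambda>w. (cmod (defect \<mu> u w))\<^sup>2 / vsize G w) summable_on (V - L)"
proof -
  define g where "g w = (up_weight w)\<^sup>2 * (cmod (u (par w)))\<^sup>2 / vsize G w" for w
  define U where "U v = (cmod (u v))\<^sup>2 / vsize G v" for v
  have U: "U summable_on V" "\<And>v. U v \<ge> 0"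
    using wl2_summable[OF u] by (auto simp: U_def[abs_def] vsize_nonneg)
  have inner: "g summable_on {w \<in> V - L. par w \<in> V - L}"
  proof (rule nonneg_bdd_above_summable_on)
    show "bdd_above (sum g ` {X. X \<subseteq> {w \<in> V - L. par w \<in> V - L} \<and> finite X})"
    proof (rule bdd_aboveI2)
      fix X assume "X \<in> {X. X \<subseteq> {w \<in> V - L. par w \<in> V - L} \<and> finite X}"
      then have X: "finite X" "\<And>w. w \<in> X \<Longrightarrow> w \<in> V - L \<and> par w \<in> V - L" by auto
      have "sum g X = (\<Sum>v\<in>par ` X. \<Sum>w\<in>{w \<in> X. par w = v}. g w)"
        by (rule sum.image_gen[OF X(1)])
      also have "\<dots> \<le> (\<Sum>v\<in>par ` X. real q * U v)"
      proof (rule sum_mono)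
        fix v assume "v \<in> par ` X"
        then have v: "v \<in> V - L" using X by auto
        have "(\<Sum>w\<in>{w \<in> X. par w = v}. g w) \<le> (\<Sum>w\<in>ch v. (up_weight w)\<^sup>2 / vsize G w * (cmod (u v))\<^sup>2)"
        proof -
          have "(\<Sum>w\<in>{w \<in> X. par w = v}. g w) = (\<Sum>w\<in>{w \<in> X. par w = v}. (up_weight w)\<^sup>2 / vsize G w * (cmod (u v))\<^sup>2)"
            by (intro sum.cong) (auto simp: g_def)
          also have "\<dots> \<le> (\<Sum>w\<in>ch v. (up_weight w)\<^sup>2 / vsize G w * (cmod (u v))\<^sup>2)"
            using X v by (intro sum_mono2 finite_ch) (auto simp: ch_def vsize_nonneg)
          finally show ?thesis .
        qed
        also have "\<dots> = real q * U v"
          unfolding sum_distrib_right[symmetric] sum_up_weight_square[OF v] by (simp add: U_def)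
        finally show "(\<Sum>w\<in>{w \<in> X. par w = v}. g w) \<le> real q * U v" .
      qed
      also have "\<dots> \<le> real q * infsum U V"
        unfolding sum_distrib_left[symmetric] using X U
        by (intro mult_left_mono finite_sum_le_infsum) auto
      finally show "sum g X \<le> real q * infsum U V" .
    qed
  qed (simp add: g_def vsize_nonneg)
  have roots: "g summable_on (\<Union>v\<in>L. ch v)"
    using finite_L finite_ch L_subset by (intro summable_on_finite) auto
  have ends: "V - L = {w \<in> V - L. par w \<in> V - L} \<union> (\<Union>v\<in>L. ch v)"
    using par_in_verts by (auto simp: ch_def)
  have "g summable_on {w \<in> V - L. par w \<in> V - L} \<union> (\<Union>v\<in>L. ch v)"
    using inner roots by (rule summable_on_Un_disjoint) (auto simp: ch_def)
  then have g: "g summable_on (V - L)" unfolding ends[symmetric] .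
  \<comment> \<open>For \<open>\<mu> = 0\<close> both this and the quotient in \<open>defect\<close>
    are 0, so that case is included.\<close>
  define c where "c = 1 / cmod (of_real (sqrt (real q)) * \<mu>)"
  have "(\<lambda>w. 2 * U w + 2 * c\<^sup>2 * g w) summable_on (V - L)"
    by (intro summable_on_add summable_on_cmult_right g summable_on_subset_banach[OF U(1)]) auto
  then show ?thesis
  proof (rule summable_on_comparison_test)
    fix w assume "w \<in> V - L"
    have "cmod (defect \<mu> u w) \<le> cmod (u w) + c * \<bar>up_weight w\<bar> * cmod (u (par w))"
      unfolding defect_def c_def
      by (rule order_trans[OF norm_triangle_ineq4]) (simp add: norm_mult norm_divide)
    then have "(cmod (defect \<mu> u w))\<^sup>2 \<le> (cmod (u w) + c * \<bar>up_weight w\<bar> * cmod (u (par w)))\<^sup>2"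
      by (intro power_mono) auto
    also have "\<dots> \<le> 2 * (cmod (u w))\<^sup>2 + 2 * (c * \<bar>up_weight w\<bar> * cmod (u (par w)))\<^sup>2"
      using sum_squares_bound[of "cmod (u w)" "c * \<bar>up_weight w\<bar> * cmod (u (par w))"] by (simp add: power2_sum)
    finally have "(cmod (defect \<mu> u w))\<^sup>2 / vsize G w \<le>
        (2 * (cmod (u w))\<^sup>2 + 2 * (c * \<bar>up_weight w\<bar> * cmod (u (par w)))\<^sup>2) / vsize G w"
      by (rule divide_right_mono) (rule vsize_nonneg)
    then show "(cmod (defect \<mu> u w))\<^sup>2 / vsize G w \<le> 2 * U w + 2 * c\<^sup>2 * g w"
      by (simp add: U_def g_def power_mult_distrib add_divide_distrib mult_ac)
  qed (simp add: vsize_nonneg)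
qed

text \<open>
  Above the source, summing the energy inequality over all vertices shows that the energy of the
  defect is at least \<open>\<bar>\<mu>\<bar>\<^sup>2\<close> times itself.
\<close>

lemma defect_eq_0:
  assumes \<mu>: "cmod \<mu> > 1" and u: "u \<in> ell2 G" and eq: "shifted_adjacency G q \<mu> u = delta y"
    and w: "w \<in> V - L" "ht y < ht w"
  shows "defect \<mu> u w = 0"
proof -
  \<comment> \<open>Closed under children and without the source.\<close>
  define T where "T = {w \<in> V - L. ht y < ht w}"
  define g where "g w = (cmod (defect \<mu> u w))\<^sup>2 / vsize G w" for w
  have g0: "g w \<ge> 0" for w by (simp add: g_def vsize_nonneg)
  have g: "g summable_on T"
    unfolding g_def[abs_def]
    by (rule summable_on_subset_banach[OF defect_summable[OF u]]) (auto simp: T_def)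
  have ch: "ch w \<subseteq> T" "finite (ch w)" if "w \<in> T" for w
    using that chD[of _ w] finite_ch[of w] by (auto simp: T_def dest: less_trans)
  have "infsum (\<lambda>w. (cmod \<mu>)\<^sup>2 * g w) T \<le> infsum g T"
  proof (rule infsum_le_finite_sums)
    show "(\<lambda>w. (cmod \<mu>)\<^sup>2 * g w) summable_on T" using g by (rule summable_on_cmult_right)
    fix X assume X: "finite X" "X \<subseteq> T"
    have "(\<Sum>w\<in>X. (cmod \<mu>)\<^sup>2 * g w) \<le> (\<Sum>w\<in>X. \<Sum>c\<in>ch w. g c)"
      unfolding g_def
    proof (intro sum_mono defect_energy[OF eq])
      show "\<mu> \<noteq> 0" using \<mu> by auto
    qed (use X in \<open>auto simp: T_def delta_def\<close>)
    \<comment> \<open>Different vertices have disjoint sets of children, so no energy is counted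
      twice.\<close>
    also have "\<dots> = sum g (\<Union>w\<in>X. ch w)"
      using X ch by (intro sum.UNION_disjoint[symmetric]) (auto simp: ch_def)
    also have "\<dots> \<le> infsum g T"
      using X ch g0 by (intro finite_sum_le_infsum g) auto
    finally show "(\<Sum>w\<in>X. (cmod \<mu>)\<^sup>2 * g w) \<le> infsum g T" .
  qed
  moreover have "infsum (\<lambda>w. (cmod \<mu>)\<^sup>2 * g w) T = (cmod \<mu>)\<^sup>2 * infsum g T"
    using g by (intro infsum_cmult_right)
  moreover have "(cmod \<mu>)\<^sup>2 > 1" using \<mu> by (simp add: one_less_power)
  ultimately have "((cmod \<mu>)\<^sup>2 - 1) * infsum g T \<le> 0" by (simp add: algebra_simps)
  with \<open>(cmod \<mu>)\<^sup>2 > 1\<close> have "infsum g T \<le> 0" by (simp add: mult_le_0_iff)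
  moreover have "sum g {w} \<le> infsum g T"
    using w g0 by (intro finite_sum_le_infsum g) (auto simp: T_def)
  ultimately have "g w = 0" using g0[of w] by simp
  then show ?thesis using vsize_pos[of w] w by (simp add: g_def)
qed

section \<open>Solutions determined by the core\<close>

definition solves :: "complex \<Rightarrow> 'v \<Rightarrow> ('v \<Rightarrow> complex) \<Rightarrow> bool" where
  "solves \<mu> y u \<longleftrightarrow> cmod \<mu> > 1 \<and> u \<in> ell2 G \<and> shifted_adjacency G q \<mu> u = delta y"

text \<open>\<open>defect_eq\<close> is run from the children to the parent, starting above the
  source where the defect is 0. The resulting function does not depend on \<open>u\<close>.\<close>

lemma defect_holomorphic:
  assumes "w \<in> V - L"
  shows "\<exists>g. g holomorphic_on - {0} \<and> (\<forall>\<mu> u. solves \<mu> y u \<longrightarrow> defect \<mu> u w = g \<mu>)"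
  using assms
\<comment> \<open>The truncated difference is positive exactly when \<open>w\<close> is not above
  \<open>y\<close>, and then it drops at each child.\<close>
proof (induction "Suc (ht y) - ht w" arbitrary: w rule: less_induct)
  case less
  show ?case
  proof (cases "ht y < ht w")
    case True
    then show ?thesis using less.prems
      by (intro exI[of _ "\<lambda>_. 0"]) (auto simp: solves_def defect_eq_0)
  next
    case False
    have "\<forall>c\<in>ch w. \<exists>g. g holomorphic_on - {0} \<and> (\<forall>\<mu> u. solves \<mu> y u \<longrightarrow> defect \<mu> u c = g \<mu>)"
      using False by (intro ballI less.hyps) (auto dest!: chD)
    from bchoice[OF this] obtain g where g: "\<And>c. c \<in> ch w \<Longrightarrow> g c holomorphic_on - {0}"
      "\<And>c \<mu> u. c \<in> ch w \<Longrightarrow> solves \<mu> y u \<Longrightarrow> defect \<mu> u c = g c \<mu>" by blast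
    define G' where "G' \<mu> = ((\<Sum>c\<in>ch w. of_real (down_weight c) * g c \<mu>) - 2 * of_real (sqrt (real q)) * delta y w) /
      (of_real (sqrt (real q)) * \<mu>)" for \<mu>
    have "G' holomorphic_on - {0}"
      unfolding G'_def[abs_def] using q by (intro holomorphic_intros g) auto
    moreover have "defect \<mu> u w = G' \<mu>" if "solves \<mu> y u" for \<mu> u
    proof -
      have \<mu>: "\<mu> \<noteq> 0" and eq: "shifted_adjacency G q \<mu> u = delta y"
        using that by (auto simp: solves_def)
      have "(\<Sum>c\<in>ch w. of_real (down_weight c) * defect \<mu> u c) = (\<Sum>c\<in>ch w. of_real (down_weight c) * g c \<mu>)"
        using g(2) that by (intro sum.cong) auto
      with defect_eq[OF eq \<mu> less.prems] show ?thesis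
        using \<mu> q by (simp add: G'_def field_simps)
    qed
    ultimately show ?thesis by blast
  qed
qed

text \<open>The order of the quantifiers matters: \<open>t\<close> and \<open>a\<close> serve all
  sources, and only \<open>k\<close> depends on \<open>y\<close>.\<close>

lemma outgoing_extension:
  assumes "x \<in> V"
  shows "\<exists>t\<in>L. \<exists>a. a holomorphic_on - {0} \<and> (\<forall>y. \<exists>k. k holomorphic_on - {0} \<and>
    (\<forall>\<mu> u. solves \<mu> y u \<longrightarrow> u x = a \<mu> * u t + k \<mu>))"
  using assms
proof (induction "ht x" arbitrary: x rule: less_induct)
  case less
  show ?case
  proof (cases "x \<in> L")
    case True
    then show ?thesis
      by (intro bexI[of _ x] exI[of _ "\<lambda>_. 1"] conjI allI exI[of _ "\<lambda>_. 0"]) auto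
  next
    case False
    with less.prems have x: "x \<in> V - L" by auto
    from less.hyps[OF ht_par[OF x] par_in_verts[OF x]] obtain t a where t: "t \<in> L"
      and a: "a holomorphic_on - {0}"
      and k: "\<And>y. \<exists>k. k holomorphic_on - {0} \<and> (\<forall>\<mu> u. solves \<mu> y u \<longrightarrow> u (par x) = a \<mu> * u t + k \<mu>)"
      by blast
    define c where "c \<mu> = of_real (up_weight x) / (of_real (sqrt (real q)) * \<mu>)" for \<mu> :: complex
    have c: "c holomorphic_on - {0}"
      unfolding c_def[abs_def] using q by (intro holomorphic_intros) auto
    have "\<exists>k. k holomorphic_on - {0} \<and> (\<forall>\<mu> u. solves \<mu> y u \<longrightarrow> u x = (c \<mu> * a \<mu>) * u t + k \<mu>)" for y
    proof -
      obtain k where k: "k holomorphic_on - {0}" "\<And>\<mu> u. solves \<mu> y u \<Longrightarrow> u (par x) = a \<mu> * u t + k \<mu>"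
        using k by blast
      obtain g where g: "g holomorphic_on - {0}" "\<And>\<mu> u. solves \<mu> y u \<Longrightarrow> defect \<mu> u x = g \<mu>"
        using defect_holomorphic[OF x] by blast
      have "u x = (c \<mu> * a \<mu>) * u t + (g \<mu> + c \<mu> * k \<mu>)" if "solves \<mu> y u" for \<mu> u
        using k(2)[OF that] g(2)[OF that] by (simp add: defect_def c_def algebra_simps add_divide_distrib)
      moreover have "(\<lambda>\<mu>. g \<mu> + c \<mu> * k \<mu>) holomorphic_on - {0}"
        by (intro holomorphic_intros g k c)
      ultimately show ?thesis by blast
    qed
    moreover have "(\<lambda>\<mu>. c \<mu> * a \<mu>) holomorphic_on - {0}" by (intro holomorphic_intros a c)
    ultimately show ?thesis using t by blast
  qed
qed

text \<open>The equation at a core vertex, with the children expressed by their defects, times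
  \<open>\<mu> / sqrt q\<close> to clear \<open>inverse \<mu>\<close>. On the core the sum of
  weights need not be q, which leaves the constant coefficient.\<close>

lemma core_equation:
  assumes sol: "solves \<mu> y u" and v: "v \<in> L"
  shows "\<mu>\<^sup>2 * u v - \<mu> * (\<Sum>w\<in>L. core_weight v w / of_real (sqrt (real q)) * u w) +
      (1 - of_real (\<Sum>c\<in>ch v. down_weight c * up_weight c) / of_nat q) * u v =
    \<mu> / of_real (sqrt (real q)) *
      ((\<Sum>c\<in>ch v. of_real (down_weight c) * defect \<mu> u c) - 2 * of_real (sqrt (real q)) * delta y v)"
proof -
  define s where "s = complex_of_real (sqrt (real q))"
  have s: "s \<noteq> 0" "s * s = of_nat q"
    using q by (simp_all add: s_def flip: of_real_mult)
  have \<mu>: "\<mu> \<noteq> 0" and eq: "shifted_adjacency G q \<mu> u = delta y"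
    using sol by (auto simp: solves_def)
  define D where "D = (\<Sum>c\<in>ch v. of_real (down_weight c) * defect \<mu> u c)"
  define P where "P = complex_of_real (\<Sum>c\<in>ch v. down_weight c * up_weight c)"
  define M where "M = (\<Sum>w\<in>L. core_weight v w * u w)"
  have "D = (\<Sum>c\<in>ch v. of_real (down_weight c) * u c) - (\<Sum>c\<in>ch v. of_real (down_weight c * up_weight c)) / (s * \<mu>) * u v"
    unfolding D_def sum_distrib_right sum_divide_distrib sum_subtractf[symmetric]
    by (intro sum.cong) (auto simp: defect_def s_def ch_def algebra_simps)
  then have "(\<Sum>c\<in>ch v. of_real (down_weight c) * u c) = D + P / (s * \<mu>) * u v" by (simp add: P_def)
  then have main: "s * (\<mu> + inverse \<mu>) * u v + 2 * s * delta y v = M + (D + P / (s * \<mu>) * u v)"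
    using adjacency_core[OF v, of u] shifted_adjacency_eqD[OF eq, of v] by (simp add: s_def M_def)
  have "(\<Sum>w\<in>L. core_weight v w / s * u w) = M / s"
    by (simp add: M_def sum_divide_distrib)
  moreover have "\<mu>\<^sup>2 * u v - \<mu> * (M / s) + (1 - P / (s * s)) * u v = \<mu> / s * (D - 2 * s * delta y v)"
  proof -
    have "\<mu> / s * (s * (\<mu> + inverse \<mu>) * u v + 2 * s * delta y v) = \<mu> / s * (M + (D + P / (s * \<mu>) * u v))"
      using main by simp
    moreover have "\<mu> / s * (s * (\<mu> + inverse \<mu>) * u v + 2 * s * delta y v) = \<mu>\<^sup>2 * u v + u v + 2 * \<mu> * delta y v"
      using s(1) \<mu> by (simp add: field_simps power2_eq_square)
    moreover have "\<mu> / s * (M + (D + P / (s * \<mu>) * u v)) = \<mu> * (M / s) + \<mu> / s * D + P / (s * s) * u v"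
      using s(1) \<mu> by (simp add: field_simps)
    moreover have "\<mu> / s * (D - 2 * s * delta y v) = \<mu> / s * D - 2 * \<mu> * delta y v"
      using s(1) by (simp add: field_simps)
    ultimately show ?thesis by (simp add: algebra_simps)
  qed
  ultimately show ?thesis by (simp add: s(2) D_def P_def flip: s_def)
qed

text \<open>The matrices of \<open>core_equation\<close> do not involve the source, so one
  \<open>p\<close> serves all \<open>y\<close>; the source enters through the right-hand side
  only.\<close>

lemma core_polynomial:
  "\<exists>p :: complex poly. p \<noteq> 0 \<and> Polynomial.degree p = 2 * card L \<and>
    (\<forall>y. \<forall>v\<in>L. \<exists>h. h holomorphic_on - {0} \<and> (\<forall>\<mu> u. solves \<mu> y u \<longrightarrow> poly p \<mu> * u v = h \<mu>))"
proof -
  define M where "M v w = core_weight v w / of_real (sqrt (real q))" for v w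
  define K where "K v = 1 - complex_of_real (\<Sum>c\<in>ch v. down_weight c * up_weight c) / of_nat q" for v
  obtain p Q where p: "p \<noteq> 0" "Polynomial.degree p = 2 * card L"
    and Q: "\<And>\<mu> x y v. (\<forall>v\<in>L. \<mu>\<^sup>2 * x v - \<mu> * (\<Sum>w\<in>L. M v w * x w) + K v * x v = y v) \<Longrightarrow> v \<in> L \<Longrightarrow>
       poly p \<mu> * x v = (\<Sum>w\<in>L. poly (Q v w) \<mu> * y w)"
    using quadratic_system_poly[OF finite_L, of M K] by blast
  have "\<exists>h. h holomorphic_on - {0} \<and> (\<forall>\<mu> u. solves \<mu> y u \<longrightarrow> poly p \<mu> * u v = h \<mu>)"
    if v: "v \<in> L" for y v
  proof -
    have "\<forall>c\<in>V - L. \<exists>g. g holomorphic_on - {0} \<and> (\<forall>\<mu> u. solves \<mu> y u \<longrightarrow> defect \<mu> u c = g \<mu>)"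
      using defect_holomorphic by blast
    from bchoice[OF this] obtain g where g: "\<And>c. c \<in> V - L \<Longrightarrow> g c holomorphic_on - {0}"
      "\<And>c \<mu> u. c \<in> V - L \<Longrightarrow> solves \<mu> y u \<Longrightarrow> defect \<mu> u c = g c \<mu>" by blast
    define r where "r w \<mu> = \<mu> / of_real (sqrt (real q)) *
      ((\<Sum>c\<in>ch w. of_real (down_weight c) * g c \<mu>) - 2 * of_real (sqrt (real q)) * delta y w)" for w \<mu>
    have r: "r w holomorphic_on - {0}" for w
      unfolding r_def[abs_def] using q by (intro holomorphic_intros g) (auto simp: ch_def)
    have poly_hol: "poly s holomorphic_on A" for s :: "complex poly" and A
      using poly_analytic by (rule analytic_imp_holomorphic)
    have "poly p \<mu> * u v = (\<Sum>w\<in>L. poly (Q v w) \<mu> * r w \<mu>)" if sol: "solves \<mu> y u" for \<mu> u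
    proof (rule Q[OF _ v], rule ballI)
      fix w assume w: "w \<in> L"
      have "(\<Sum>c\<in>ch w. of_real (down_weight c) * defect \<mu> u c) = (\<Sum>c\<in>ch w. of_real (down_weight c) * g c \<mu>)"
        using g(2) sol by (intro sum.cong) (auto simp: ch_def)
      then show "\<mu>\<^sup>2 * u w - \<mu> * (\<Sum>w'\<in>L. M w w' * u w') + K w * u w = r w \<mu>"
        using core_equation[OF sol w] by (simp add: M_def K_def r_def)
    qed
    moreover have "(\<lambda>\<mu>. \<Sum>w\<in>L. poly (Q v w) \<mu> * r w \<mu>) holomorphic_on - {0}"
      by (intro holomorphic_intros r poly_hol)
    ultimately show ?thesis by blast
  qed
  with p show ?thesis by blast
qed

end

section \<open>Counting resonances\<close>

text \<open>
  \<open>t x\<close> is the core vertex at which the end containing \<open>x\<close> is attached, and \<open>a x\<close> is the outgoing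
  solution on that end.
\<close>

lemma principal_part_formula:
  fixes q :: nat and G :: "('v, 'e, 'g, 'h) gog"
  assumes q: "q \<ge> 2" and gf: "geometrically_finite q G F L Fs Cs"
  shows "\<exists>(p :: complex poly) t a. p \<noteq> 0 \<and> Polynomial.degree p = 2 * card L \<and>
    (\<forall>x \<in> verts (ugraph G). t x \<in> L) \<and>
    (\<forall>b \<mu>\<^sub>0 N J C. resolvent_principal_part G q b \<mu>\<^sub>0 N J C \<longrightarrow> \<mu>\<^sub>0 \<noteq> 0 \<longrightarrow>
      (\<forall>f \<in> wl2 G (exp_weight G q b (- N)). \<forall>j \<in> {1..J}. \<forall>x \<in> verts (ugraph G).
        C j f x = (\<Sum>i<Polynomial.order \<mu>\<^sub>0 p. fps_nth (fps_expansion (a x) \<mu>\<^sub>0) i *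
          (if j + i \<le> J then C (j + i) f (t x) else 0))))"
proof -
  let ?V = "verts (ugraph G)"
  interpret decomp: geometrically_finite_decomposition q G F L Fs Cs
    by unfold_locales (rule gf)
  have LV: "L \<subseteq> ?V" by (rule decomp.component_subset) simp
  obtain up ht where s1: "\<forall>w \<in> ?V - L. up w \<in> in_arcs (ugraph G) w \<and> ht (tail (ugraph G) (up w)) < (ht w :: nat)"
    and s2: "\<forall>w \<in> ?V - L. in_arcs (ugraph G) w =
        insert (up w) ((\<lambda>c. flip G (up c)) ` {c \<in> ?V - L. tail (ugraph G) (up c) = w})"
    and s3: "\<forall>w \<in> L. in_arcs (ugraph G) w = {e \<in> in_arcs (ugraph G) w. tail (ugraph G) e \<in> L} \<union>
        (\<lambda>c. flip G (up c)) ` {c \<in> ?V - L. tail (ugraph G) (up c) = w}"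
    and s4: "\<forall>w \<in> ?V - L. (\<Sum>c\<in>{c \<in> ?V - L. tail (ugraph G) (up c) = w}.
        vsize G w * vsize G c / (esize G (up c))\<^sup>2) = real q"
    using decomp.end_structure by blast
  interpret rooted_ends G q L up ht
    by unfold_locales
      (rule q decomp.finite_core LV conjunct1[OF bspec[OF s1]] conjunct2[OF bspec[OF s1]]
        bspec[OF s2] bspec[OF s3] bspec[OF s4], assumption?)+
  obtain p :: "complex poly" where p: "p \<noteq> 0" "Polynomial.degree p = 2 * card L"
    and p_core: "\<forall>y. \<forall>v\<in>L. \<exists>h. h holomorphic_on - {0} \<and> (\<forall>\<mu> u. solves \<mu> y u \<longrightarrow> poly p \<mu> * u v = h \<mu>)"
    using core_polynomial by blast
  have "\<forall>x\<in>?V. \<exists>ta. fst ta \<in> L \<and> snd ta holomorphic_on - {0} \<and> (\<forall>y. \<exists>k. k holomorphic_on - {0} \<and>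
    (\<forall>\<mu> u. solves \<mu> y u \<longrightarrow> u x = snd ta \<mu> * u (fst ta) + k \<mu>))"
    using outgoing_extension by fastforce
  from bchoice[OF this] obtain ta where ta: "\<forall>x\<in>?V. fst (ta x) \<in> L \<and> snd (ta x) holomorphic_on - {0} \<and>
    (\<forall>y. \<exists>k. k holomorphic_on - {0} \<and> (\<forall>\<mu> u. solves \<mu> y u \<longrightarrow> u x = snd (ta x) \<mu> * u (fst (ta x)) + k \<mu>))" ..
  define t where "t x = fst (ta x)" for x
  define a where "a x = snd (ta x)" for x
  have t: "t x \<in> L" and a: "a x holomorphic_on - {0}" if "x \<in> ?V" for x
    using ta that by (auto simp: t_def a_def)
  define h where "h y v = (SOME h. h holomorphic_on - {0} \<and> (\<forall>\<mu> u. solves \<mu> y u \<longrightarrow> poly p \<mu> * u v = h \<mu>))" for y v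
  have h: "h y v holomorphic_on - {0} \<and> (\<forall>\<mu> u. solves \<mu> y u \<longrightarrow> poly p \<mu> * u v = h y v \<mu>)" if "v \<in> L" for y v
  proof -
    have "\<exists>h. h holomorphic_on - {0} \<and> (\<forall>\<mu> u. solves \<mu> y u \<longrightarrow> poly p \<mu> * u v = h \<mu>)"
      using p_core that by blast
    from someI_ex[OF this] show ?thesis unfolding h_def .
  qed
  define k where "k y x = (SOME k. k holomorphic_on - {0} \<and>
    (\<forall>\<mu> u. solves \<mu> y u \<longrightarrow> u x = a x \<mu> * u (t x) + k \<mu>))" for y x
  have k: "k y x holomorphic_on - {0} \<and> (\<forall>\<mu> u. solves \<mu> y u \<longrightarrow> u x = a x \<mu> * u (t x) + k y x \<mu>)"
    if "x \<in> ?V" for y x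
  proof -
    have "\<exists>k. k holomorphic_on - {0} \<and> (\<forall>\<mu> u. solves \<mu> y u \<longrightarrow> u x = a x \<mu> * u (t x) + k \<mu>)"
      unfolding t_def a_def using ta that by blast
    from someI_ex[OF this] show ?thesis unfolding k_def .
  qed
  show ?thesis
  proof (intro exI[of _ p] exI[of _ t] exI[of _ a] conjI allI impI ballI)
    fix b \<mu>\<^sub>0 N J C f j x
    assume pp: "resolvent_principal_part G q b \<mu>\<^sub>0 N J C" "\<mu>\<^sub>0 \<noteq> 0"
      and fjx: "f \<in> wl2 G (exp_weight G q b (- N))" "j \<in> {1..J}" "x \<in> ?V"
    show "C j f x = (\<Sum>i<Polynomial.order \<mu>\<^sub>0 p. fps_nth (fps_expansion (a x) \<mu>\<^sub>0) i *
          (if j + i \<le> J then C (j + i) f (t x) else 0))"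
    proof (rule resolvent_principal_part_formula[where L=L and h=h and k=k, OF q _ LV _ p(1) _ _ _ _ _ pp fjx])
      show "poly p \<mu> * u v = h y v \<mu>"
        if "cmod \<mu> > 1" "u \<in> ell2 G" "shifted_adjacency G q \<mu> u = delta y" "v \<in> L" for \<mu> u y v
        using h[OF that(4)] that(1-3) by (auto simp: solves_def)
      show "u x = a x \<mu> * u (t x) + k y x \<mu>"
        if "cmod \<mu> > 1" "u \<in> ell2 G" "shifted_adjacency G q \<mu> u = delta y" "x \<in> ?V" for \<mu> u y x
        using k[OF that(4)] that(1-3) by (auto simp: solves_def)
    qed (use t a h k decomp.vsize_pos in auto)
  qed (use p t in auto)
qed

theorem theorem1p3:
  fixes q :: nat
    and G :: "('v, 'e, 'g, 'h) gog"
    and F :: "'e set" and L :: "'v set" and Fs Cs :: "'v set set"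
    and b :: 'v
  assumes "q \<ge> 2"
    and "geometrically_finite q G F L Fs Cs"
    and "b \<in> L"
  shows "finite (resonances G q b) \<and>
    card (resonances G q b) \<le> 2 * card L \<and>
    (\<forall>\<mu>\<^sub>0 \<in> resonances G q b. \<forall>m. has_multiplicity G q b \<mu>\<^sub>0 m \<longrightarrow>
       m \<le> 3 * (card L + 2 * card Cs + (q + 1) * card Fs)\<^sup>2)"
proof -
  let ?V = "verts (ugraph G)"
  have fin_L: "finite L" using assms(2) by (simp add: geometrically_finite_def)
  obtain p :: "complex poly" and t a where p: "p \<noteq> 0" "Polynomial.degree p = 2 * card L"
    and t: "\<forall>x \<in> ?V. t x \<in> L"
    and all: "\<forall>b \<mu>\<^sub>0 N J C. resolvent_principal_part G q b \<mu>\<^sub>0 N J C \<longrightarrow> \<mu>\<^sub>0 \<noteq> 0 \<longrightarrow>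
      (\<forall>f \<in> wl2 G (exp_weight G q b (- N)). \<forall>j \<in> {1..J}. \<forall>x \<in> ?V.
        C j f x = (\<Sum>i<Polynomial.order \<mu>\<^sub>0 p. fps_nth (fps_expansion (a x) \<mu>\<^sub>0) i *
          (if j + i \<le> J then C (j + i) f (t x) else 0)))"
    using principal_part_formula[OF assms(1,2)] by (elim exE conjE) (rule that)
  have formula: "C j f x = (\<Sum>i<Polynomial.order \<mu>\<^sub>0 p. fps_nth (fps_expansion (a x) \<mu>\<^sub>0) i *
          (if j + i \<le> J then C (j + i) f (t x) else 0))"
    if "resolvent_principal_part G q b \<mu>\<^sub>0 N J C" "\<mu>\<^sub>0 \<noteq> 0"
      "f \<in> wl2 G (exp_weight G q b (- N))" "j \<in> {1..J}" "x \<in> ?V" for \<mu>\<^sub>0 N J C f j x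
    using all that by blast
  \<comment> \<open>\<open>formula\<close> speaks of vertices; elsewhere functions of the target
    space are 0.\<close>
  have outside: "C j f x = 0"
    if "resolvent_principal_part G q b \<mu>\<^sub>0 N J C" "f \<in> wl2 G (exp_weight G q b (- N))" "j \<in> {1..J}" "x \<notin> ?V"
    for \<mu>\<^sub>0 N J C f j x
  proof -
    have "bounded_op G (exp_weight G q b (- N)) (exp_weight G q b N) (C j)"
      using that(1,3) unfolding resolvent_principal_part_def has_principal_part_def by blast
    then have "C j f \<in> wl2 G (exp_weight G q b N)" using that(2) by (simp add: bounded_op_def)
    then show ?thesis using that(4) by (rule wl2_outside)
  qed
  have roots: "resonances G q b \<subseteq> {\<mu>. poly p \<mu> = 0}"
  proof
    fix \<mu>\<^sub>0 assume "\<mu>\<^sub>0 \<in> resonances G q b"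
    then obtain N J C j f where \<mu>\<^sub>0: "\<mu>\<^sub>0 \<noteq> 0" and pp: "resolvent_principal_part G q b \<mu>\<^sub>0 N J C"
      and j: "j \<in> {1..J}" and f: "f \<in> wl2 G (exp_weight G q b (- N))" and nz: "C j f \<noteq> 0"
      unfolding resonances_def by blast
    show "\<mu>\<^sub>0 \<in> {\<mu>. poly p \<mu> = 0}"
    proof (rule ccontr)
      assume "\<mu>\<^sub>0 \<notin> {\<mu>. poly p \<mu> = 0}"
      \<comment> \<open>At a non-root the sum in \<open>formula\<close> is empty.\<close>
      then have "Polynomial.order \<mu>\<^sub>0 p = 0" by (simp add: order_0I)
      then have "C j f x = 0" for x
        using formula[OF pp \<mu>\<^sub>0 f j, of x] outside[OF pp f j, of x] by (cases "x \<in> ?V") auto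
      then show False using nz by (simp add: fun_eq_iff)
    qed
  qed
  have "finite (resonances G q b)"
    using roots poly_roots_finite[OF p(1)] by (rule finite_subset)
  moreover have "card (resonances G q b) \<le> 2 * card L"
    using card_mono[OF poly_roots_finite[OF p(1)] roots] card_poly_roots_bound[OF p(1)] p(2) by simp
  moreover have "m \<le> 3 * (card L + 2 * card Cs + (q + 1) * card Fs)\<^sup>2"
    if res: "\<mu>\<^sub>0 \<in> resonances G q b" and mult: "has_multiplicity G q b \<mu>\<^sub>0 m" for \<mu>\<^sub>0 m
  proof -
    have \<mu>\<^sub>0: "\<mu>\<^sub>0 \<noteq> 0" using res by (simp add: resonances_def)
    obtain N J C where pp: "resolvent_principal_part G q b \<mu>\<^sub>0 N J C"
      and m: "m = cfun.dim (cfun.span (\<Union>j \<in> {1..J}. C j ` wl2 G (exp_weight G q b (- N))))"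
      using mult unfolding has_multiplicity_def by blast
    define n where "n = Polynomial.order \<mu>\<^sub>0 p"
    \<comment> \<open>The \<open>i\<close>-th Taylor coefficient at \<open>\<mu>\<^sub>0\<close> of
      the outgoing solution attached at \<open>v\<close>, extended by 0.\<close>
    define \<phi> where "\<phi> = (\<lambda>(v, i) x. if x \<in> ?V \<and> t x = v then fps_nth (fps_expansion (a x) \<mu>\<^sub>0) i else 0)"
    define B where "B = \<phi> ` (L \<times> {..<n})"
    have "C j f \<in> cfun.span B" if j: "j \<in> {1..J}" and f: "f \<in> wl2 G (exp_weight G q b (- N))" for j f
    proof -
      \<comment> \<open>The coordinates of \<open>C j f\<close> are core values of the coefficients
        from \<open>C j\<close> on; the spanning set \<open>B\<close> is the same for all
        \<open>j\<close> and \<open>f\<close>.\<close>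
      define c where "c = (\<lambda>(v, i). if j + i \<le> J then C (j + i) f v else 0)"
      have "C j f x = (\<Sum>vi \<in> L \<times> {..<n}. c vi * \<phi> vi x)" for x
      proof (cases "x \<in> ?V")
        case True
        have "(\<Sum>vi \<in> L \<times> {..<n}. c vi * \<phi> vi x) = (\<Sum>v\<in>L. \<Sum>i<n. c (v, i) * \<phi> (v, i) x)"
          by (simp add: sum.cartesian_product)
        also have "\<dots> = (\<Sum>v\<in>L. if v = t x then \<Sum>i<n. c (t x, i) * \<phi> (t x, i) x else 0)"
          by (intro sum.cong) (auto simp: \<phi>_def)
        also have "\<dots> = (\<Sum>i<n. c (t x, i) * \<phi> (t x, i) x)" using t True fin_L by simp
        also have "\<dots> = C j f x"
          unfolding formula[OF pp \<mu>\<^sub>0 f j True] n_def[symmetric]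
          using True by (intro sum.cong) (auto simp: c_def \<phi>_def)
        finally show ?thesis by simp
      next
        case False
        then show ?thesis using outside[OF pp f j False] by (auto simp: \<phi>_def intro!: sum.neutral)
      qed
      then have "C j f = (\<Sum>vi \<in> L \<times> {..<n}. cscale (c vi) (\<phi> vi))"
        by (simp add: fun_eq_iff sum_fun_apply cscale_def)
      also have "\<dots> \<in> cfun.span B"
        by (intro cfun.span_sum cfun.span_scale cfun.span_base) (simp add: B_def)
      finally show ?thesis .
    qed
    then have "(\<Union>j \<in> {1..J}. C j ` wl2 G (exp_weight G q b (- N))) \<subseteq> cfun.span B" by blast
    then have "cfun.span (\<Union>j \<in> {1..J}. C j ` wl2 G (exp_weight G q b (- N))) \<subseteq> cfun.span B"
      by (rule cfun.span_minimal) (rule cfun.subspace_span)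
    then have "m \<le> card B"
      unfolding m by (rule cfun.dim_le_card) (simp add: B_def fin_L)
    also have "\<dots> \<le> card (L \<times> {..<n})" unfolding B_def using fin_L by (intro card_image_le) simp
    also have "\<dots> = card L * n" by (simp add: card_cartesian_product)
    \<comment> \<open>The order of a root is at most the degree of \<open>p\<close>.\<close>
    also have "\<dots> \<le> card L * (2 * card L)"
      using order_degree[OF p(1), of \<mu>\<^sub>0] p(2) by (intro mult_left_mono) (simp_all add: n_def)
    also have "\<dots> \<le> 3 * (card L)\<^sup>2" by (simp add: power2_eq_square)
    also have "\<dots> \<le> 3 * (card L + 2 * card Cs + (q + 1) * card Fs)\<^sup>2"
      by (intro mult_left_mono power_mono) auto
    finally show ?thesis .
  qed
  ultimately show ?thesis by blast
qed

end
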